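(* Let $1\le k\le n-1$ and let $W_\sigma$ be a stratum in $G_{n,k}$. There is a canonical trivialization: the map $h_\sigma=(\hat\mu,p_\sigma): W_\sigma/T^n\to\mathring{P}_\sigma\times F_\sigma$ is a homeomorphism.
   Context: $G_{n,k}$ is the Grassmann manifold of $k$-dimensional complex subspaces of $\mathbb{C}^n$, with the actions of $T^n=(S^1)^n\subset(\mathbb{C}^* )^n$ induced by the coordinatewise action on $\mathbb{C}^n$. $P^I(L)$, $I\subset\{1,\dots,n\}$, $|I|=k$, are the Pl\"ucker coordinates of $L$. For a set $\sigma$ of $k$-element subsets, $W_\sigma=\{L: P^I(L)\ne0\iff I\in\sigma\}$; if nonempty it is called a stratum. Let $\Lambda_I\in\mathbb{R}^n$ be the vector with $(\Lambda_I)_j=1$ for $j\in I$ and $0$ otherwise. The moment map is $\mu:G_{n,k}\to\mathbb{R}^n$, $\mu(L)=\frac{1}{\sum_I|P^I(L)|^2}\sum_I|P^I(L)|^2\Lambda_I$; it is $T^n$-invariant. $P_\sigma$ is the convex hull of $\{\Lambda_I:I\in\sigma\}$, $\mathring{P}_\sigma$ its relative interior; one has $\mu(W_\sigma)=\mathring{P}_\sigma$, and $\hat\mu:W_\sigma/T^n\to\mathring{P}_\sigma$ is the induced map. $F_\sigma=W_\sigma/(\mathbb{C}^* )^n$ with the quotient topology, and $p_\sigma:W_\sigma/T^n\to F_\sigma$ is the canonical projection. *)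

theory Defs
  imports "HOL-Analysis.Analysis"
begin

text \<open>
  The coordinates of \<open>\<complex>\<^sup>n\<close> are indexed by a finite linearly ordered type \<^typ>\<open>'n\<close>, and the
  dimension \<open>k\<close> is the cardinality of a second such type \<^typ>\<open>'k\<close>. The order only fixes the signs of
  minors. For every \<open>n \<ge> 1\<close> the numeral type \<open>n\<close> is an instance. Constants whose other arguments do
  not determine \<^typ>\<open>'k\<close> take it as an argument of type \<^typ>\<open>'k itself\<close>.
\<close>


section \<open>Quotient topologies\<close>

definition quotient_topology :: "'a topology \<Rightarrow> ('a \<Rightarrow> 'b) \<Rightarrow> 'b topology" where
  "quotient_topology X f =
     topology (\<lambda>U. U \<subseteq> f ` topspace X \<and> openin X {x \<in> topspace X. f x \<in> U})"

lemma openin_quotient_topology: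
  "openin (quotient_topology X f) U \<longleftrightarrow>
     U \<subseteq> f ` topspace X \<and> openin X {x \<in> topspace X. f x \<in> U}"
proof -
  have "istopology (\<lambda>U. U \<subseteq> f ` topspace X \<and> openin X {x \<in> topspace X. f x \<in> U})"
    unfolding istopology_def
  proof (intro conjI allI impI)
    fix S T
    assume S: "S \<subseteq> f ` topspace X \<and> openin X {x \<in> topspace X. f x \<in> S}"
      and T: "T \<subseteq> f ` topspace X \<and> openin X {x \<in> topspace X. f x \<in> T}"
    have "{x \<in> topspace X. f x \<in> S \<inter> T}
            = {x \<in> topspace X. f x \<in> S} \<inter> {x \<in> topspace X. f x \<in> T}" by auto
    with S T show "openin X {x \<in> topspace X. f x \<in> S \<inter> T}" by (simp only: openin_Int)
    from S show "S \<inter> T \<subseteq> f ` topspace X" by auto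
  next
    fix \<K>
    assume K: "\<forall>K\<in>\<K>. K \<subseteq> f ` topspace X \<and> openin X {x \<in> topspace X. f x \<in> K}"
    have "{x \<in> topspace X. f x \<in> \<Union>\<K>} = (\<Union>K\<in>\<K>. {x \<in> topspace X. f x \<in> K})" by auto
    moreover have "openin X (\<Union>K\<in>\<K>. {x \<in> topspace X. f x \<in> K})"
      using K by (intro openin_Union) auto
    ultimately show "openin X {x \<in> topspace X. f x \<in> \<Union>\<K>}" by (simp only:)
    from K show "\<Union>\<K> \<subseteq> f ` topspace X" by auto
  qed
  then show ?thesis
    unfolding quotient_topology_def by (simp add: topology_inverse')
qed

lemma topspace_quotient_topology: "topspace (quotient_topology X f) = f ` topspace X"
proof
  show "topspace (quotient_topology X f) \<subseteq> f ` topspace X"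
    using openin_topspace[of "quotient_topology X f"] unfolding openin_quotient_topology by (rule conjunct1)
  have "{x \<in> topspace X. f x \<in> f ` topspace X} = topspace X" by auto
  then have "openin (quotient_topology X f) (f ` topspace X)"
    by (simp add: openin_quotient_topology)
  then show "f ` topspace X \<subseteq> topspace (quotient_topology X f)"
    by (rule openin_subset)
qed

lemma quotient_map_quotient_topology: "quotient_map X (quotient_topology X f) f"
  by (auto simp: quotient_map_def topspace_quotient_topology openin_quotient_topology)


section \<open>The Grassmann manifold and Pluecker coordinates\<close>

definition grassmannian :: "'k::finite itself \<Rightarrow> (complex^'n) set set" where
  "grassmannian (k :: 'k itself) = {L. vec.subspace L \<and> vec.dim L = CARD('k)}"

text \<open>The rows of a frame form a basis of the subspace that it represents.\<close>

definition frames :: "(complex^'n^'k) set" where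
  "frames = {A. rank A = CARD('k)}"

definition row_space :: "complex^'n^'k \<Rightarrow> (complex^'n) set" where
  "row_space A = vec.span (rows A)"

text \<open>The usual topology of the Grassmann manifold, as the quotient of the space of frames by
  \<open>GL\<^sub>k\<close>.\<close>

definition grassmannian_topology :: "'k::finite itself \<Rightarrow> (complex^'n) set topology" where
  "grassmannian_topology (k :: 'k itself) =
     quotient_topology (top_of_set (frames :: (complex^'n^'k) set)) row_space"

definition subset_enum :: "'n::{finite,linorder} set \<Rightarrow> 'k::{finite,linorder} \<Rightarrow> 'n" where
  "subset_enum I = (THE e. strict_mono e \<and> range e = I)"

definition minor :: "complex^'n::{finite,linorder}^'k::{finite,linorder} \<Rightarrow> 'n set \<Rightarrow> complex" where
  "minor A I = det (\<chi> (i::'k) (j::'k). A $ i $ subset_enum I j)"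

text \<open>The Pluecker coordinates of \<open>L\<close> are homogeneous coordinates: they are the maximal minors of a
  frame of \<open>L\<close>, and another frame multiplies all of them by one nonzero scalar (lemma
  \<open>minor_row_space_eq\<close>). Here they are evaluated on an arbitrary but fixed frame.\<close>

definition pluecker ::
  "'k::{finite,linorder} itself \<Rightarrow> (complex^'n::{finite,linorder}) set \<Rightarrow> 'n set \<Rightarrow> complex" where
  "pluecker (k :: 'k itself) L I =
     minor (SOME A :: complex^'n::{finite,linorder}^'k::{finite,linorder}. A \<in> frames \<and> row_space A = L) I"

definition k_subsets :: "'k::finite itself \<Rightarrow> 'n::finite set set" where
  "k_subsets (k :: 'k itself) = {I. card I = CARD('k)}"

definition stratum ::
  "'k::{finite,linorder} itself \<Rightarrow> 'n set set \<Rightarrow> (complex^'n::{finite,linorder}) set set" where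
  "stratum k \<sigma> = {L \<in> grassmannian k. \<forall>I \<in> k_subsets k. pluecker k L I \<noteq> 0 \<longleftrightarrow> I \<in> \<sigma>}"


section \<open>The moment map\<close>

definition Lambda :: "'n set \<Rightarrow> real^'n" where
  "Lambda I = (\<chi> j. if j \<in> I then 1 else 0)"

definition moment_map ::
  "'k::{finite,linorder} itself \<Rightarrow> (complex^'n::{finite,linorder}) set \<Rightarrow> real^'n::{finite,linorder}" where
  "moment_map k L =
     (1 / (\<Sum>I\<in>k_subsets k. (cmod (pluecker k L I))\<^sup>2)) *\<^sub>R
       (\<Sum>I\<in>k_subsets k. (cmod (pluecker k L I))\<^sup>2 *\<^sub>R Lambda I)"

definition polytope_of :: "'n set set \<Rightarrow> (real^'n) set" where
  "polytope_of \<sigma> = convex hull (Lambda ` \<sigma>)"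


section \<open>Torus actions and orbit spaces\<close>

definition compact_torus :: "(complex^'n) set" where
  "compact_torus = {t. \<forall>i. cmod (t $ i) = 1}"

definition algebraic_torus :: "(complex^'n) set" where
  "algebraic_torus = {t. \<forall>i. t $ i \<noteq> 0}"

definition torus_act :: "complex^'n \<Rightarrow> (complex^'n) set \<Rightarrow> (complex^'n) set" where
  "torus_act t L = (\<lambda>x. \<chi> i. t $ i * x $ i) ` L"

definition torus_orbit :: "(complex^'n) set \<Rightarrow> (complex^'n) set \<Rightarrow> (complex^'n) set set" where
  "torus_orbit H L = (\<lambda>t. torus_act t L) ` H"

definition orbit_space ::
  "(complex^'n) set \<Rightarrow> (complex^'n) set topology \<Rightarrow> (complex^'n) set set topology" where
  "orbit_space H X = quotient_topology X (torus_orbit H)"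

definition stratum_topology ::
  "'k::{finite,linorder} itself \<Rightarrow> 'n set set \<Rightarrow> (complex^'n::{finite,linorder}) set topology" where
  "stratum_topology k \<sigma> = subtopology (grassmannian_topology k) (stratum k \<sigma>)"

definition F_space ::
  "'k::{finite,linorder} itself \<Rightarrow> 'n set set \<Rightarrow>
     (complex^'n::{finite,linorder}) set set topology" where
  "F_space k \<sigma> = orbit_space algebraic_torus (stratum_topology k \<sigma>)"

text \<open>The map induced on orbits by a map \<open>f\<close> that is constant on every orbit \<open>Q\<close>.\<close>

definition induced_map :: "('a \<Rightarrow> 'b) \<Rightarrow> 'a set \<Rightarrow> 'b" where
  "induced_map f Q = the_elem (f ` Q)"

definition mu_hat ::
  "'k::{finite,linorder} itself \<Rightarrow> (complex^'n::{finite,linorder}) set set \<Rightarrow> real^'n::{finite,linorder}" where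
  "mu_hat k = induced_map (moment_map k)"

definition p_map :: "(complex^'n) set set \<Rightarrow> (complex^'n) set set" where
  "p_map = induced_map (torus_orbit algebraic_torus)"

definition h_map ::
  "'k::{finite,linorder} itself \<Rightarrow> (complex^'n::{finite,linorder}) set set \<Rightarrow>
     (real^'n::{finite,linorder}) \<times> (complex^'n::{finite,linorder}) set set" where
  "h_map k Q = (mu_hat k Q, p_map Q)"


section \<open>Well-definedness\<close>

lemma subset_enum:
  fixes I :: "'n::{finite,linorder} set"
  assumes I: "card I = CARD('k::{finite,linorder})"
  shows "strict_mono (subset_enum I :: 'k \<Rightarrow> 'n)" "range (subset_enum I :: 'k \<Rightarrow> 'n) = I"
proof -
  define l where "l = sorted_list_of_set I"
  have l: "sorted_wrt (<) l" "set l = I" "length l = CARD('k)"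
    using I by (auto simp: l_def)
  define r where "r x = card {y::'k. y < x}" for x
  have r_less: "r x < r y" if "x < y" for x y
    unfolding r_def by (rule psubset_card_mono) (use that in auto)
  have r_bound: "r x < length l" for x
    unfolding r_def l by (rule psubset_card_mono) auto
  have mono: "strict_mono (\<lambda>x. l ! r x)"
    by (rule strict_monoI) (use r_less r_bound l(1) in \<open>auto intro: sorted_wrt_nth_less\<close>)
  have "range (\<lambda>x. l ! r x) \<subseteq> I"
    using r_bound l(2) nth_mem by blast
  moreover have "card (range (\<lambda>x. l ! r x)) = card I"
    using strict_mono_imp_inj_on[OF mono] I by (simp add: card_image)
  ultimately have range: "range (\<lambda>x. l ! r x) = I"
    by (simp add: card_subset_eq)
  have unique: "e = e'"
    if "strict_mono e \<and> range e = I" "strict_mono e' \<and> range e' = I" for e e' :: "'k \<Rightarrow> 'n"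
  proof -
    let ?u = "sorted_list_of_set (UNIV :: 'k set)"
    have "map f ?u = sorted_list_of_set I" if f: "strict_mono f \<and> range f = I" for f :: "'k \<Rightarrow> 'n"
    proof (rule strict_sorted_equal)
      have "sorted_wrt (<) ?u" by simp
      then show "sorted_wrt (<) (map f ?u)"
        unfolding sorted_wrt_map
        by (rule sorted_wrt_mono_rel[rotated]) (use f in \<open>auto simp: strict_mono_def\<close>)
    qed (use f in auto)
    with that have "map e ?u = map e' ?u" by simp
    then show ?thesis by (auto simp: map_eq_conv)
  qed
  have "\<exists>!e :: 'k \<Rightarrow> 'n. strict_mono e \<and> range e = I"
    using mono range unique by blast
  from theI'[OF this] show "strict_mono (subset_enum I :: 'k \<Rightarrow> 'n)"
    "range (subset_enum I :: 'k \<Rightarrow> 'n) = I"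
    by (simp_all add: subset_enum_def)
qed

lemma row_space_frame_exists:
  fixes L :: "(complex^'n) set"
  assumes "L \<in> grassmannian TYPE('k::finite)"
  shows "\<exists>A :: complex^'n^'k. A \<in> frames \<and> row_space A = L"
proof -
  from assms have L: "vec.subspace L" "vec.dim L = CARD('k)"
    by (auto simp: grassmannian_def)
  obtain B where B: "B \<subseteq> L" "vec.independent B" "L \<subseteq> vec.span B" "card B = vec.dim L"
    using vec.basis_exists by blast
  have "finite B" using B(2) by (rule vec.finiteI_independent)
  then obtain f where f: "bij_betw f (UNIV :: 'k set) B"
    using B(4) L(2) finite_same_card_bij[of "UNIV :: 'k set" B] by auto
  define A :: "complex^'n^'k" where "A = (\<chi> i. f i)"
  have "rows A = B"
    using f by (auto simp: rows_def row_def A_def bij_betw_def)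
  moreover have "vec.span B = L"
    using B L(1) by (simp add: subset_antisym vec.span_minimal)
  ultimately show ?thesis
    using L(2) vec.dim_eq_card_independent[OF B(2)] B(4)
    by (intro exI[of _ A]) (simp add: frames_def row_space_def row_rank_def_gen)
qed

lemma row_space_frame_in_grassmannian:
  fixes A :: "complex^'n^'k"
  assumes "A \<in> frames"
  shows "row_space A \<in> grassmannian TYPE('k)"
  using assms by (simp add: grassmannian_def frames_def row_space_def row_rank_def_gen)

lemma topspace_grassmannian:
  "topspace (grassmannian_topology TYPE('k::finite)) =
     (grassmannian TYPE('k) :: (complex^'n) set set)"
proof -
  have "row_space ` (frames :: (complex^'n^'k) set) = grassmannian TYPE('k)"
    using row_space_frame_exists row_space_frame_in_grassmannian by blast
  then show ?thesis
    by (simp add: grassmannian_topology_def topspace_quotient_topology)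
qed

lemma frame_right_inverse:
  fixes A :: "complex^'n^'k"
  assumes "A \<in> frames"
  shows "\<exists>R :: complex^'k^'n. A ** R = mat 1"
proof -
  have rows: "rows A = range (\<lambda>i. row i A)" by (auto simp: rows_def)
  have dim: "vec.dim (rows A) = CARD('k)"
    using assms by (simp add: frames_def row_rank_def_gen)
  have "card (rows A) \<le> CARD('k)" unfolding rows by (rule card_image_le) simp
  moreover have "vec.dim (rows A) \<le> card (rows A)"
    by (rule vec.dim_le_card) (auto simp: rows vec.span_base)
  ultimately have card: "card (rows A) = CARD('k)" using dim by simp
  then have inj: "inj (\<lambda>i. row i A)" unfolding rows by (simp add: eq_card_imp_inj_on)
  have ind: "vec.independent (rows A)"
    by (rule vec.card_le_dim_spanning[of _ "rows A"]) 
      (auto simp: rows vec.span_base dim card[unfolded rows] dim[unfolded rows])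
  have "c i = 0" if "(\<Sum>i\<in>UNIV. c i *s row i A) = 0" for c i
  proof -
    have "(\<Sum>v\<in>rows A. c (inv (\<lambda>i. row i A) v) *s v) = 0"
      unfolding rows by (subst sum.reindex[OF inj]) (simp add: inv_f_f[OF inj] that)
    then have "c (inv (\<lambda>i. row i A) (row i A)) = 0"
      using vec.independentD[OF ind _ subset_refl, of "\<lambda>v. c (inv (\<lambda>i. row i A) v)" "row i A"]
      by (auto simp: rows)
    then show ?thesis using inv_f_f[OF inj, of i] by simp
  qed
  then show ?thesis
    unfolding matrix_right_invertible_independent_rows by blast
qed

lemma row_space_subset_factor:
  fixes A B :: "complex^'n^'k"
  assumes "row_space A \<subseteq> row_space B"
  shows "\<exists>M :: complex^'k^'k. A = M ** B"
proof -
  have comb: "\<exists>c. x = (\<Sum>i\<in>UNIV. c i *s row i B)" if "x \<in> vec.span (rows B)" for x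
    using that
  proof (induction rule: vec.span_induct_alt)
    case base
    show ?case by (rule exI[of _ "\<lambda>_. 0"]) simp
  next
    case (step a v y)
    then obtain c j where c: "y = (\<Sum>i\<in>UNIV. c i *s row i B)" and j: "v = row j B"
      by (auto simp: rows_def)
    have "a *s v + y = (\<Sum>i\<in>UNIV. ((if i = j then a else 0) + c i) *s row i B)"
      by (simp add: vec.scale_left_distrib sum.distrib c j
          if_distrib[of "\<lambda>a. a *s _"] cong: if_cong)
    then show ?case by (rule exI[of _ "\<lambda>i. (if i = j then a else 0) + c i"])
  qed
  have "row i A \<in> vec.span (rows B)" for i
    using assms vec.span_base[of "row i A" "rows A"] by (auto simp: row_space_def rows_def)
  then have "\<exists>c. row i A = (\<Sum>j\<in>UNIV. c j *s row j B)" for i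
    using comb by blast
  then obtain c where "row i A = (\<Sum>j\<in>UNIV. c i j *s row j B)" for i by metis
  then have "A = (\<chi> i j. c i j) ** B"
    by (simp add: vec_eq_iff matrix_matrix_mult_def row_def)
  then show ?thesis by blast
qed

lemma minor_matrix_mult:
  fixes B :: "complex^'n::{finite,linorder}^'k::{finite,linorder}"
  shows "minor (M ** B) I = det M * minor B I"
proof -
  have "(\<chi> (i::'k) (j::'k). (M ** B) $ i $ subset_enum I j) = M ** (\<chi> i j. B $ i $ subset_enum I j)"
    by (simp add: vec_eq_iff matrix_matrix_mult_def)
  then show ?thesis by (simp add: minor_def det_mul)
qed

lemma minor_row_space_eq:
  fixes A B :: "complex^'n::{finite,linorder}^'k::{finite,linorder}"
  assumes A: "A \<in> frames" and AB: "row_space A = row_space B"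
  shows "\<exists>c. c \<noteq> 0 \<and> (\<forall>I. minor A I = c * minor B I)"
proof -
  obtain M N :: "complex^'k::{finite,linorder}^'k::{finite,linorder}" where M: "A = M ** B" and N: "B = N ** A"
    using row_space_subset_factor[of A B] row_space_subset_factor[of B A] AB by auto
  obtain R :: "complex^'k::{finite,linorder}^'n::{finite,linorder}" where R: "A ** R = mat 1"
    using frame_right_inverse[OF A] by blast
  have "A = (M ** N) ** A"
    unfolding matrix_mul_assoc[symmetric] N[symmetric] by (rule M)
  then have "A ** R = (M ** N) ** (A ** R)" by (simp add: matrix_mul_assoc)
  then have "M ** N = mat 1" by (simp add: R)
  then have "det M * det N = 1" by (metis det_mul det_I)
  then have "det M \<noteq> 0" by auto
  then show ?thesis
    unfolding M minor_matrix_mult by blast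
qed

end

theory Submission
  imports Defs
begin

text \<open>
  The moment of \<open>exp (s / 2) \<cdot> L\<close> is \<open>x\<close> exactly when \<open>s\<close> is a critical point of the convex function
  \<open>G(s) = (\<Sum>I\<in>\<sigma>. \<bar>P\<^sup>I(L)\<bar>\<^sup>2 exp \<langle>\<Lambda>\<^sub>I - x, s\<rangle>)\<close>, because \<open>exp (s / 2)\<close> multiplies \<open>\<bar>P\<^sup>I\<bar>\<^sup>2\<close> by
  \<open>exp \<langle>\<Lambda>\<^sub>I, s\<rangle>\<close>. On the direction space of the polytope \<open>G\<close> is strictly convex, and it is coercive
  when \<open>x\<close> lies in the relative interior; so the moment map sends each \<open>(\<complex>\<^sup>*)\<^sup>n\<close>-orbit modulo the
  compact torus bijectively onto the relative interior. If \<open>L\<close> itself has moment \<open>x\<close>, then \<open>G\<close> exceeds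
  \<open>G(0)\<close> on every small sphere. By compactness of the sphere this persists when \<open>L\<close> and \<open>x\<close> are
  perturbed, so the perturbed \<open>G\<close> still has a critical point inside the small ball. Together with
  the openness of the orbit map onto \<open>F\<^sub>\<sigma>\<close>, this makes the trivialization an open map.
\<close>


section \<open>Means with exponential weights\<close>

text \<open>The gradient at \<open>s\<close> is the sum of the vectors \<open>l i - x\<close> with
  weights \<open>a i * exp ((l i - x) \<bullet> s)\<close>. For positive \<open>a\<close>, its
  vanishing expresses that \<open>x\<close> is the mean of the points \<open>l i\<close> under these
  weights.\<close>

definition expsum :: "'i set \<Rightarrow> ('i \<Rightarrow> 'a::real_inner) \<Rightarrow> ('i \<Rightarrow> real) \<Rightarrow> 'a \<Rightarrow> 'a \<Rightarrow> real" where
  "expsum \<sigma> l a x s = (\<Sum>i\<in>\<sigma>. a i * exp ((l i - x) \<bullet> s))"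

text \<open>The linear space parallel to the affine hull of the points \<open>l i\<close>. For
  \<open>x\<close> in that hull, moving \<open>s\<close> orthogonally to this space leaves
  \<open>expsum\<close> unchanged, so strict convexity is sought on this space.\<close>

definition direction_space :: "'i set \<Rightarrow> ('i \<Rightarrow> 'a::real_vector) \<Rightarrow> 'a set" where
  "direction_space \<sigma> l = span {l i - l j | i j. i \<in> \<sigma> \<and> j \<in> \<sigma>}"

lemma exp_gt_add_one_self:
  fixes t :: real
  assumes "t \<noteq> 0"
  shows "1 + t < exp t"
proof -
  have "exp t \<noteq> 1 + t"
    using ln_eq_minus_one[of "exp t"] assms by auto
  then show ?thesis using exp_ge_add_one_self[of t] by linarith
qed

lemma diff_mem_direction_space:
  assumes "finite \<sigma>" "i \<in> \<sigma>" "sum c \<sigma> = 1"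
  shows "l i - (\<Sum>j\<in>\<sigma>. c j *\<^sub>R l j) \<in> direction_space \<sigma> l"
proof -
  have "l i - (\<Sum>j\<in>\<sigma>. c j *\<^sub>R l j) = (\<Sum>j\<in>\<sigma>. c j *\<^sub>R (l i - l j))"
    by (simp add: scaleR_diff_right sum_subtractf assms flip: scaleR_sum_left)
  moreover have "\<dots> \<in> direction_space \<sigma> l"
    unfolding direction_space_def
    by (intro span_sum span_scale span_base) (use assms(2) in blast)
  ultimately show ?thesis by simp
qed

text \<open>Such an \<open>s\<close> is orthogonal to all differences \<open>l i - l j\<close>,
  hence to their span, hence to itself.\<close>

lemma orthogonal_direction_space:
  fixes s :: "'a::real_inner"
  assumes "s \<in> direction_space \<sigma> l" "\<And>i. i \<in> \<sigma> \<Longrightarrow> (l i - x) \<bullet> s = 0"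
  shows "s = 0"
proof -
  have "y \<bullet> s = 0" if "y \<in> direction_space \<sigma> l" for y
    using that unfolding direction_space_def
  proof (induction rule: span_induct_alt)
    case (step c v y)
    then obtain i j where "v = (l i - x) - (l j - x)" "i \<in> \<sigma>" "j \<in> \<sigma>" by auto
    then have "v \<bullet> s = 0" using assms(2) by (simp add: inner_diff_left)
    then show ?case using step by (simp add: inner_left_distrib)
  qed simp
  with assms(1) show ?thesis by (metis inner_eq_zero_iff)
qed

text \<open>A minimum over the compact set \<open>V \<inter> cball 0 e\<close> cannot lie on the
  bounding sphere, because \<open>0\<close> does better than every point there. At an interior
  minimum the derivative along the gradient vanishes; this direction is admissible since the
  gradient lies in \<open>V\<close>.\<close>

lemma exponential_weights_critical_point:
  fixes l :: "'i \<Rightarrow> 'a::euclidean_space"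
  assumes fin: "finite \<sigma>" and V: "subspace V" and x: "\<And>i. i \<in> \<sigma> \<Longrightarrow> l i - x \<in> V"
    and e: "0 \<le> e"
    and sphere: "\<And>s. s \<in> V \<Longrightarrow> norm s = e \<Longrightarrow> expsum \<sigma> l a x 0 < expsum \<sigma> l a x s"
  obtains s where "s \<in> V" "norm s < e"
    "(\<Sum>i\<in>\<sigma>. (a i * exp (l i \<bullet> s)) *\<^sub>R l i) = (\<Sum>i\<in>\<sigma>. a i * exp (l i \<bullet> s)) *\<^sub>R x"
proof -
  have "compact (V \<inter> cball 0 e)"
    using closed_subspace[OF V] by (simp add: closed_Int_compact)
  moreover have 0: "0 \<in> V \<inter> cball 0 e" using e subspace_0[OF V] by simp
  moreover have "continuous_on (V \<inter> cball 0 e) (expsum \<sigma> l a x)"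
    unfolding expsum_def by (intro continuous_intros)
  ultimately obtain s where s: "s \<in> V \<inter> cball 0 e"
      and min: "\<And>y. y \<in> V \<inter> cball 0 e \<Longrightarrow> expsum \<sigma> l a x s \<le> expsum \<sigma> l a x y"
    using continuous_attains_inf[of "V \<inter> cball 0 e" "expsum \<sigma> l a x"] by blast
  have sV: "s \<in> V" using s by simp
  have "norm s \<noteq> e" using min[OF 0] sphere[OF sV] by force
  with s have less: "norm s < e" by simp
  \<comment> \<open>The gradient of \<open>expsum\<close> at \<open>s\<close>; the derivative along
    it is \<open>w \<bullet> w\<close>.\<close>
  define w where "w = (\<Sum>i\<in>\<sigma>. (a i * exp ((l i - x) \<bullet> s)) *\<^sub>R (l i - x))"
  have wV: "w \<in> V"
    unfolding w_def by (intro subspace_sum[OF V] subspace_scale[OF V] x)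
  \<comment> \<open>A step length that keeps \<open>s + \<tau> *\<^sub>R w\<close> in the ball. The
    summand \<open>1\<close> keeps the denominator positive when \<open>w = 0\<close>.\<close>
  define d where "d = (e - norm s) / (norm w + 1)"
  have pos: "0 < norm w + 1" by (simp add: add_nonneg_pos)
  have d: "0 < d" using less pos by (simp add: d_def)
  have "((\<lambda>\<tau>. expsum \<sigma> l a x (s + \<tau> *\<^sub>R w)) has_real_derivative
          (\<Sum>i\<in>\<sigma>. a i * (exp ((l i - x) \<bullet> (s + 0 *\<^sub>R w)) * ((l i - x) \<bullet> w)))) (at 0)"
    unfolding expsum_def inner_add_right inner_scaleR_right
    by (auto intro!: derivative_eq_intros sum.cong simp: fin)
  moreover have "expsum \<sigma> l a x (s + 0 *\<^sub>R w) \<le> expsum \<sigma> l a x (s + \<tau> *\<^sub>R w)" if "\<bar>0 - \<tau>\<bar> < d" for \<tau>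
  proof -
    have "norm (s + \<tau> *\<^sub>R w) \<le> norm s + \<bar>\<tau>\<bar> * norm w"
      using norm_triangle_ineq[of s "\<tau> *\<^sub>R w"] by simp
    also have "\<bar>\<tau>\<bar> * norm w \<le> d * (norm w + 1)"
      using that by (intro mult_mono) auto
    also have "d * (norm w + 1) = e - norm s" using pos by (simp add: d_def)
    finally have "norm (s + \<tau> *\<^sub>R w) \<le> e" by simp
    then show ?thesis
      using min[of "s + \<tau> *\<^sub>R w"] sV wV V by (simp add: subspace_add subspace_scale)
  qed
  ultimately have "(\<Sum>i\<in>\<sigma>. a i * (exp ((l i - x) \<bullet> (s + 0 *\<^sub>R w)) * ((l i - x) \<bullet> w))) = 0"
    using DERIV_local_min[OF _ d] by blast
  then have "w \<bullet> w = 0"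
    unfolding w_def inner_sum_left by (simp add: w_def[symmetric] mult.assoc)
  then have "w = 0" by simp
  \<comment> \<open>The common factor is nonzero; removing it leaves the weights
    \<open>exp (l i \<bullet> s)\<close> that the torus action produces.\<close>
  have "w = exp (- (x \<bullet> s)) *\<^sub>R (\<Sum>i\<in>\<sigma>. (a i * exp (l i \<bullet> s)) *\<^sub>R (l i - x))"
    by (simp add: w_def scaleR_sum_right inner_diff_left exp_diff exp_minus field_simps)
  with \<open>w = 0\<close> have "(\<Sum>i\<in>\<sigma>. (a i * exp (l i \<bullet> s)) *\<^sub>R (l i - x)) = 0" by simp
  then have "(\<Sum>i\<in>\<sigma>. (a i * exp (l i \<bullet> s)) *\<^sub>R l i) = (\<Sum>i\<in>\<sigma>. a i * exp (l i \<bullet> s)) *\<^sub>R x"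
    by (simp add: scaleR_diff_right sum_subtractf scaleR_sum_left)
  with sV less show ?thesis by (rule that)
qed

text \<open>Compare each exponential with its tangent \<open>1 + t\<close>: the linear terms add up
  to zero by \<open>mean\<close>. The comparison is strict for some index, since a nonzero
  \<open>s\<close> in the direction space is not orthogonal to all \<open>l i - x\<close>.\<close>

lemma expsum_gt_at_mean:
  fixes l :: "'i \<Rightarrow> 'a::euclidean_space"
  assumes fin: "finite \<sigma>" and a: "\<And>i. i \<in> \<sigma> \<Longrightarrow> 0 < a i"
    and mean: "(\<Sum>i\<in>\<sigma>. a i *\<^sub>R (l i - x)) = 0"
    and s: "s \<in> direction_space \<sigma> l" "s \<noteq> 0"
  shows "expsum \<sigma> l a x 0 < expsum \<sigma> l a x s"
proof -
  obtain j where j: "j \<in> \<sigma>" "(l j - x) \<bullet> s \<noteq> 0"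
    using orthogonal_direction_space s by blast
  have "expsum \<sigma> l a x 0 = (\<Sum>i\<in>\<sigma>. a i) + (\<Sum>i\<in>\<sigma>. a i *\<^sub>R (l i - x)) \<bullet> s"
    by (simp add: expsum_def mean)
  also have "\<dots> = (\<Sum>i\<in>\<sigma>. a i * (1 + (l i - x) \<bullet> s))"
    by (simp add: inner_sum_left sum.distrib distrib_left)
  also have "\<dots> < expsum \<sigma> l a x s"
    unfolding expsum_def
  proof (rule sum_strict_mono_ex1[OF fin])
    show "\<forall>i\<in>\<sigma>. a i * (1 + (l i - x) \<bullet> s) \<le> a i * exp ((l i - x) \<bullet> s)"
      using a by (intro ballI mult_left_mono exp_ge_add_one_self) (simp add: less_imp_le)
    show "\<exists>i\<in>\<sigma>. a i * (1 + (l i - x) \<bullet> s) < a i * exp ((l i - x) \<bullet> s)"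
      using a j exp_gt_add_one_self[OF j(2)] by (intro bexI[of _ j] mult_strict_left_mono) auto
  qed
  finally show ?thesis .
qed

text \<open>Coercivity: the positive weights \<open>c\<close> force some exponent to grow along
  every nonzero direction, and compactness of the unit sphere makes this growth uniform.\<close>

lemma expsum_gt_on_large_sphere:
  fixes l :: "'i \<Rightarrow> 'a::euclidean_space"
  assumes fin: "finite \<sigma>" and a: "\<And>i. i \<in> \<sigma> \<Longrightarrow> 0 < a i"
    and c: "\<And>i. i \<in> \<sigma> \<Longrightarrow> 0 < c i" and mean: "(\<Sum>i\<in>\<sigma>. c i *\<^sub>R (l i - x)) = 0"
  obtains R where "0 < R"
    "\<And>s. s \<in> direction_space \<sigma> l \<Longrightarrow> norm s = R \<Longrightarrow> expsum \<sigma> l a x 0 < expsum \<sigma> l a x s"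
proof -
  let ?V = "direction_space \<sigma> l"
  \<comment> \<open>Since \<open>exp t \<ge> max 0 t\<close>, this positively homogeneous function bounds \<open>expsum\<close> from below.\<close>
  define \<phi> where "\<phi> s = (\<Sum>i\<in>\<sigma>. a i * max 0 ((l i - x) \<bullet> s))" for s
  have V: "subspace ?V" unfolding direction_space_def by (rule subspace_span)
  have \<phi>_pos: "0 < \<phi> s" if s: "s \<in> ?V" "s \<noteq> 0" for s
  proof -
    \<comment> \<open>Otherwise the \<open>c\<close>-weighted sum of the inner products, which is
      zero, has no positive term; then all of them vanish and so does \<open>s\<close>.\<close>
    have "\<exists>j\<in>\<sigma>. 0 < (l j - x) \<bullet> s"
    proof (rule ccontr)
      assume "\<not> ?thesis"
      then have le: "(l i - x) \<bullet> s \<le> 0" if "i \<in> \<sigma>" for i using that by force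
      have "(\<Sum>i\<in>\<sigma>. - (c i * ((l i - x) \<bullet> s))) = - ((\<Sum>i\<in>\<sigma>. c i *\<^sub>R (l i - x)) \<bullet> s)"
        by (simp add: inner_sum_left sum_negf)
      then have "(\<Sum>i\<in>\<sigma>. - (c i * ((l i - x) \<bullet> s))) = 0" by (simp add: mean)
      then have "\<forall>i\<in>\<sigma>. - (c i * ((l i - x) \<bullet> s)) = 0"
        by (subst (asm) sum_nonneg_eq_0_iff[OF fin]) (use le c in \<open>auto simp: mult_nonneg_nonpos less_imp_le\<close>)
      then have "(l i - x) \<bullet> s = 0" if "i \<in> \<sigma>" for i using c that by force
      then show False using orthogonal_direction_space s by blast
    qed
    then obtain j where j: "j \<in> \<sigma>" "0 < (l j - x) \<bullet> s" by blast
    show ?thesis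
      unfolding \<phi>_def
      by (rule sum_pos2[OF fin j(1)]) (use a j in \<open>auto simp: less_imp_le\<close>)
  qed
  obtain \<delta> where \<delta>: "0 < \<delta>" "\<And>s. s \<in> ?V \<inter> sphere 0 1 \<Longrightarrow> \<delta> \<le> \<phi> s"
  \<comment> \<open>The sphere is empty when the direction space is zero; any positive bound then
    serves.\<close>
  proof (cases "?V \<inter> sphere 0 1 = {}")
    case True
    then show ?thesis using that[of 1] by auto
  next
    case False
    have "compact (?V \<inter> sphere 0 1)"
      using closed_subspace[OF V] by (simp add: closed_Int_compact)
    moreover have "continuous_on (?V \<inter> sphere 0 1) \<phi>"
      unfolding \<phi>_def by (intro continuous_intros)
    ultimately obtain s where "s \<in> ?V \<inter> sphere 0 1" "\<And>y. y \<in> ?V \<inter> sphere 0 1 \<Longrightarrow> \<phi> s \<le> \<phi> y"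
      using False continuous_attains_inf[of "?V \<inter> sphere 0 1" \<phi>] by blast
    then show ?thesis using that[of "\<phi> s"] \<phi>_pos by force
  qed
  \<comment> \<open>Chosen so that \<open>R * \<delta>\<close> is the absolute value of
    \<open>expsum\<close> at \<open>0\<close> plus \<open>\<delta>\<close>, hence strictly larger
    than the value at \<open>0\<close>.\<close>
  define R where "R = \<bar>expsum \<sigma> l a x 0\<bar> / \<delta> + 1"
  have R: "0 < R" using \<delta>(1) by (simp add: R_def add_nonneg_pos)
  show ?thesis
  proof (rule that[OF R])
    fix s assume s: "s \<in> ?V" "norm s = R"
    define u where "u = (1 / R) *\<^sub>R s"
    have u: "s = R *\<^sub>R u" "u \<in> ?V \<inter> sphere 0 1"
      using s R V by (auto simp: u_def subspace_scale)
    have "expsum \<sigma> l a x 0 < R * \<delta>"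
      using \<delta>(1) by (simp add: R_def distrib_right)
    also have "\<dots> \<le> R * \<phi> u" using \<delta>(2)[OF u(2)] R by simp
    also have "\<dots> = (\<Sum>i\<in>\<sigma>. a i * (R * max 0 ((l i - x) \<bullet> u)))"
      by (simp add: \<phi>_def sum_distrib_left mult_ac)
    also have "\<dots> \<le> expsum \<sigma> l a x s"
      unfolding expsum_def
    proof (intro sum_mono mult_left_mono)
      fix i assume i: "i \<in> \<sigma>"
      have "R * max 0 ((l i - x) \<bullet> u) = max 0 ((l i - x) \<bullet> s)"
        using R by (simp add: u(1) max_mult_distrib_left)
      also have "\<dots> \<le> exp ((l i - x) \<bullet> s)"
        using exp_ge_add_one_self[of "(l i - x) \<bullet> s"] exp_ge_zero[of "(l i - x) \<bullet> s"] by linarith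
      finally show "R * max 0 ((l i - x) \<bullet> u) \<le> exp ((l i - x) \<bullet> s)" .
    qed (use a in \<open>simp add: less_imp_le\<close>)
    finally show "expsum \<sigma> l a x 0 < expsum \<sigma> l a x s" .
  qed
qed

text \<open>Monotonicity of the gradient: pairing both mean equations with \<open>s\<close>, after
  rescaling the second by \<open>exp (- (x \<bullet> s))\<close>, and subtracting gives a vanishing
  sum of terms \<open>a i * ((exp t - 1) * t)\<close> with \<open>t = (l i - x) \<bullet> s\<close>.
  Each term is nonnegative and is zero only for \<open>t = 0\<close>.\<close>

lemma exponential_weights_mean_unique:
  fixes l :: "'i \<Rightarrow> 'a::real_inner"
  assumes fin: "finite \<sigma>" and a: "\<And>i. i \<in> \<sigma> \<Longrightarrow> 0 < a i"
    and mean: "(\<Sum>i\<in>\<sigma>. a i *\<^sub>R (l i - x)) = 0"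
    and mean': "(\<Sum>i\<in>\<sigma>. (a i * exp (l i \<bullet> s)) *\<^sub>R (l i - x)) = 0"
    and i: "i \<in> \<sigma>"
  shows "l i \<bullet> s = x \<bullet> s"
proof -
  let ?t = "\<lambda>i. (l i - x) \<bullet> s"
  have 1: "(\<Sum>i\<in>\<sigma>. a i * ?t i) = 0"
    using arg_cong[OF mean, of "\<lambda>v. v \<bullet> s"] by (simp add: inner_sum_left)
  have "(\<Sum>i\<in>\<sigma>. a i * exp (l i \<bullet> s) * ?t i) = 0"
    using arg_cong[OF mean', of "\<lambda>v. v \<bullet> s"] by (simp add: inner_sum_left)
  then have "exp (- (x \<bullet> s)) * (\<Sum>i\<in>\<sigma>. a i * exp (l i \<bullet> s) * ?t i) = 0" by simp
  then have 2: "(\<Sum>i\<in>\<sigma>. a i * exp (?t i) * ?t i) = 0"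
    by (simp add: sum_distrib_left inner_diff_left exp_diff exp_minus field_simps)
  have "(\<Sum>i\<in>\<sigma>. a i * ((exp (?t i) - 1) * ?t i)) = 0"
    using 1 2 by (simp add: left_diff_distrib right_diff_distrib sum_subtractf mult.assoc)
  moreover have nonneg: "0 \<le> (exp t - 1) * t" for t :: real
    by (cases "0 \<le> t") (auto intro!: mult_nonneg_nonneg mult_nonpos_nonpos)
  ultimately have "a i * ((exp (?t i) - 1) * ?t i) = 0"
    by (subst (asm) sum_nonneg_eq_0_iff[OF fin]) (use a i in \<open>auto simp: less_imp_le\<close>)
  then have "?t i = 0" using a[OF i] by auto
  then show ?thesis by (simp add: inner_diff_left)
qed

text \<open>The inequality is an open condition on \<open>((a, x), s)\<close>, and the sphere in
  \<open>V\<close> is compact, so the tube lemma gives one neighbourhood valid for all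
  \<open>s\<close>. The weights are packed into a vector to give the parameters their Euclidean
  topology.\<close>

lemma expsum_gt_on_sphere_open:
  fixes l :: "'i::finite \<Rightarrow> 'a::euclidean_space"
  assumes gt: "\<And>s. s \<in> V \<Longrightarrow> norm s = e \<Longrightarrow> expsum \<sigma> l (($) a0) x0 0 < expsum \<sigma> l (($) a0) x0 s"
    and V: "subspace V"
  obtains U where "open U" "(a0, x0) \<in> U"
    "\<And>a x s. (a, x) \<in> U \<Longrightarrow> s \<in> V \<Longrightarrow> norm s = e \<Longrightarrow> expsum \<sigma> l (($) a) x 0 < expsum \<sigma> l (($) a) x s"
proof -
  define W where "W = {((a :: real^'i, x), s). expsum \<sigma> l (($) a) x 0 < expsum \<sigma> l (($) a) x s}"
  let ?C = "V \<inter> sphere 0 e"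
  have "open W"
    unfolding W_def expsum_def case_prod_unfold
    by (intro open_Collect_less continuous_intros)
  then have W: "openin (prod_topology euclidean euclidean) W"
    by (simp flip: euclidean_product_topology)
  have "compact ?C"
    using closed_subspace[OF V] by (simp add: closed_Int_compact)
  then have C: "compactin euclidean ?C" by simp
  have sub: "{(a0, x0)} \<times> ?C \<subseteq> W" using gt by (auto simp: W_def)
  obtain U V' where U: "openin euclidean U" "(a0, x0) \<in> U" "?C \<subseteq> V'" "U \<times> V' \<subseteq> W"
    using tube_lemma_right[OF W C _ sub] by (metis UNIV_I topspace_euclidean)
  have "expsum \<sigma> l (($) a) x 0 < expsum \<sigma> l (($) a) x s"
    if "(a, x) \<in> U" "s \<in> V" "norm s = e" for a x s
  proof -
    have "((a, x), s) \<in> W" using U(3,4) that by (intro subsetD[OF U(4)]) (simp add: subset_iff)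
    then show ?thesis by (simp add: W_def)
  qed
  moreover have "open U" using U(1) by simp
  ultimately show ?thesis using that U(2) by blast
qed


section \<open>Frames and minors\<close>

text \<open>The torus action on frames: right multiplication by the diagonal matrix of
  \<open>t\<close>.\<close>

definition col_scale :: "'a::semiring_1^'n \<Rightarrow> 'a^'n^'k \<Rightarrow> 'a^'n^'k" where
  "col_scale t A = (\<chi> i j. t $ j * A $ i $ j)"

text \<open>As the image of a linear map, the row space turns matrix products and column scalings
  into compositions.\<close>

lemma row_space_eq_range: "row_space A = range (\<lambda>c. c v* A)"
proof
  show "row_space A \<subseteq> range (\<lambda>c. c v* A)"
    unfolding row_space_def
  proof (rule vec.span_minimal)
    show "rows A \<subseteq> range (\<lambda>c. c v* A)"
    proof
      fix x assume "x \<in> rows A"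
      then obtain i where "x = row i A" by (auto simp: rows_def)
      then have "x = axis i 1 v* A"
        by (simp add: vec_eq_iff vector_matrix_mult_def row_def axis_def if_distrib[of "\<lambda>a. a * _"] cong: if_cong)
      then show "x \<in> range (\<lambda>c. c v* A)" by blast
    qed
    have "(*v) (transpose A) = (\<lambda>c. c v* A)" by (simp add: fun_eq_iff)
    then show "vec.subspace (range (\<lambda>c. c v* A))"
      using vec.subspace_image[OF vec.subspace_UNIV, of "transpose A"] by simp
  qed
  show "range (\<lambda>c. c v* A) \<subseteq> row_space A"
  proof
    fix x assume "x \<in> range (\<lambda>c. c v* A)"
    then obtain c where "x = c v* A" by blast
    then have "x = (\<Sum>i\<in>UNIV. c $ i *s row i A)"
      by (simp add: vec_eq_iff vector_matrix_mult_def row_def mult.commute)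
    also have "\<dots> \<in> row_space A"
      unfolding row_space_def
      by (intro vec.span_sum vec.span_scale vec.span_base) (auto simp: rows_def)
    finally show "x \<in> row_space A" .
  qed
qed

lemma torus_act_row_space: "torus_act t (row_space A) = row_space (col_scale t A)"
proof -
  have "(\<chi> i. t $ i * (c v* A) $ i) = c v* col_scale t A" for c
    by (simp add: vec_eq_iff vector_matrix_mult_def col_scale_def sum_distrib_left mult_ac)
  then show ?thesis by (simp add: torus_act_def row_space_eq_range image_image)
qed

lemma row_space_mult_subset: "row_space (M ** A) \<subseteq> row_space A"
  by (auto simp: row_space_eq_range simp flip: vector_matrix_mul_assoc)

lemma row_space_invertible_mult:
  assumes "invertible M"
  shows "row_space (M ** A) = row_space A"
proof -
  obtain N where "N ** M = mat 1" using assms by (auto simp: invertible_def)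
  then have "row_space A = row_space (N ** (M ** A))" by (simp add: matrix_mul_assoc)
  then show ?thesis
    using row_space_mult_subset[of N "M ** A"] row_space_mult_subset[of M A] by simp
qed

text \<open>A right inverse makes \<open>c \<mapsto> c v* A\<close> injective, so its image has full
  dimension. Right inverses are easily adapted to products and column scalings, unlike
  ranks.\<close>

lemma frames_iff_right_inverse:
  fixes A :: "complex^'n^'k"
  shows "A \<in> frames \<longleftrightarrow> (\<exists>R :: complex^'k^'n. A ** R = mat 1)"
proof
  assume "\<exists>R :: complex^'k^'n. A ** R = mat 1"
  then obtain R :: "complex^'k^'n" where R: "A ** R = mat 1" by blast
  have "inj (\<lambda>c. c v* A)"
  proof (rule injI)
    fix c d assume "c v* A = d v* A"
    then have "c v* A v* R = d v* A v* R" by simp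
    then show "c = d" by (simp add: vector_matrix_mul_assoc R)
  qed
  moreover have transpose: "(\<lambda>c. c v* A) = (*v) (transpose A)" by (simp add: fun_eq_iff)
  ultimately have "vec.dim (range (\<lambda>c. c v* A)) = vec.dim (UNIV :: (complex^'k) set)"
    unfolding transpose by (intro vec.dim_image_eq) (auto intro: inj_on_subset)
  then have "vec.dim (row_space A) = CARD('k)"
    by (simp add: row_space_eq_range card_cart_basis)
  then show "A \<in> frames"
    by (simp add: frames_def row_rank_def_gen row_space_def)
qed (rule frame_right_inverse)

lemma invertible_mult_in_frames:
  assumes "A \<in> frames" "invertible M"
  shows "M ** A \<in> frames"
proof -
  obtain R where "A ** R = mat 1" using assms(1) frames_iff_right_inverse by blast
  moreover obtain N where "M ** N = mat 1" using assms(2) by (auto simp: invertible_def)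
  ultimately have "(M ** A) ** (R ** N) = mat 1"
    by (metis matrix_mul_assoc matrix_mul_rid)
  then show ?thesis unfolding frames_iff_right_inverse by blast
qed

text \<open>The two change-of-basis matrices are mutually inverse because \<open>A\<close> can be
  cancelled on the right. The matrix itself is kept, as it later provides maps that move one frame
  to another within a fibre.\<close>

lemma frames_row_space_eq:
  fixes A B :: "complex^'n^'k"
  assumes A: "A \<in> frames" and eq: "row_space A = row_space B"
  obtains M :: "complex^'k^'k" where "invertible M" "A = M ** B"
proof -
  obtain M N :: "complex^'k^'k" where M: "A = M ** B" and N: "B = N ** A"
    using row_space_subset_factor[of A B] row_space_subset_factor[of B A] eq by auto
  obtain R :: "complex^'k^'n" where R: "A ** R = mat 1"
    using frame_right_inverse[OF A] by blast
  have "A = (M ** N) ** A"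
    unfolding matrix_mul_assoc[symmetric] N[symmetric] by (rule M)
  then have "A ** R = (M ** N) ** (A ** R)" by (simp add: matrix_mul_assoc)
  then have "M ** N = mat 1" by (simp add: R)
  then have "invertible M" by (auto simp: invertible_right_inverse)
  then show ?thesis using M by (rule that)
qed

lemma col_scale_in_frames:
  fixes A :: "complex^'n^'k"
  assumes "A \<in> frames" "t \<in> algebraic_torus"
  shows "col_scale t A \<in> frames"
proof -
  obtain R :: "complex^'k^'n" where R: "A ** R = mat 1" using assms(1) frames_iff_right_inverse by blast
  have "t $ i \<noteq> 0" for i using assms(2) by (simp add: algebraic_torus_def)
  then have "col_scale t A ** (\<chi> i j. inverse (t $ i) * R $ i $ j) = A ** R"
    by (simp add: vec_eq_iff matrix_matrix_mult_def col_scale_def field_simps)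
  then show ?thesis unfolding frames_iff_right_inverse R by blast
qed

lemma col_scale_col_scale: "col_scale s (col_scale t A) = col_scale (\<chi> i. s $ i * t $ i) A"
  by (simp add: col_scale_def vec_eq_iff mult.assoc)

lemma col_scale_one: "col_scale (\<chi> i. 1) A = A"
  by (simp add: col_scale_def vec_eq_iff)

lemma minor_col_scale:
  fixes A :: "complex^'n::{finite,linorder}^'k::{finite,linorder}"
  assumes "card I = CARD('k)"
  shows "minor (col_scale t A) I = (\<Prod>i\<in>I. t $ i) * minor A I"
proof -
  let ?e = "subset_enum I :: 'k \<Rightarrow> 'n"
  have e: "strict_mono ?e" "range ?e = I" using subset_enum[OF assms] by auto
  \<comment> \<open>\<open>det_rows_mul\<close> extracts factors from rows, so the scaled columns
    are transposed into rows.\<close>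
  have "(\<chi> (i::'k) (j::'k). col_scale t A $ i $ ?e j)
      = transpose (\<chi> j. t $ ?e j *s (transpose (\<chi> i j. A $ i $ ?e j) $ j))"
    by (simp add: vec_eq_iff col_scale_def transpose_def)
  then have "minor (col_scale t A) I = (\<Prod>j\<in>UNIV. t $ ?e j) * minor A I"
    unfolding minor_def by (simp only: det_transpose det_rows_mul vec_lambda_eta)
  also have "(\<Prod>j\<in>UNIV. t $ ?e j) = (\<Prod>i\<in>I. t $ i)"
    using prod.reindex[OF strict_mono_imp_inj_on[OF e(1), of UNIV], of "\<lambda>i. t $ i"] e(2)
    by (simp add: comp_def)
  finally show ?thesis .
qed

section \<open>Recovering a subspace from its maximal minors\<close>

text \<open>The selection \<open>f\<close> differs from the increasing enumeration of its range by a
  permutation. Its sign does not depend on the matrix, so one factor serves all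
  \<open>A\<close>.\<close>

lemma det_columns_eq_sign_minor:
  fixes f :: "'k::{finite,linorder} \<Rightarrow> 'n::{finite,linorder}"
  assumes "inj f"
  obtains s where "s \<noteq> 0"
    "\<And>A :: complex^'n::{finite,linorder}^'k::{finite,linorder}.
      det (\<chi> i j. A $ i $ f j) = s * minor A (range f)"
proof -
  let ?e = "subset_enum (range f) :: 'k \<Rightarrow> 'n"
  have e: "inj ?e" "range ?e = range f"
    using subset_enum[of "range f", where 'k = 'k] assms strict_mono_imp_inj_on
    by (auto simp: card_image)
  define p where "p = inv ?e \<circ> f"
  have ep: "?e (p j) = f j" for j
    unfolding p_def comp_apply by (rule f_inv_into_f) (use e in auto)
  have "inj p" by (rule injI) (metis ep assms injD)
  then have p: "p permutes UNIV"
    by (intro bij_imp_permutes) (auto simp: bij_betw_def finite_UNIV_inj_surj)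
  have "det (\<chi> i j. A $ i $ f j) = of_int (sign p) * minor A (range f)"
    for A :: "complex^'n::{finite,linorder}^'k::{finite,linorder}"
    using det_permute_columns[OF p, of "\<chi> i j. A $ i $ ?e j"] by (simp add: ep minor_def)
  then show ?thesis by (intro that[of "of_int (sign p)"]) (auto simp: sign_def)
qed

lemma det_columns_eq_0:
  assumes "\<not> inj f"
  shows "det (\<chi> i j. (A :: complex^'n::{finite,linorder}^'k::{finite,linorder}) $ i $ f j) = 0"
proof -
  obtain i j where "i \<noteq> j" "f i = f j" using assms by (auto simp: inj_def)
  then show ?thesis by (intro det_identical_columns[of i j]) (auto simp: column_def vec_eq_iff)
qed

text \<open>The columns of a frame span, so a basis can be chosen among them. The selection is
  injective because a repeated column would make the determinant zero.\<close>

lemma frame_nonzero_minor: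
  fixes A :: "complex^'n::{finite,linorder}^'k::{finite,linorder}"
  assumes "A \<in> frames"
  obtains f :: "'k \<Rightarrow> 'n" where "inj f" "det (\<chi> i j. A $ i $ f j) \<noteq> 0"
proof -
  have span: "vec.span (columns A) = UNIV"
    using assms by (simp add: frames_iff_right_inverse matrix_right_invertible_span_columns)
  obtain B where B: "B \<subseteq> columns A" "vec.independent B" "columns A \<subseteq> vec.span B" "card B = vec.dim (columns A)"
    using vec.basis_exists by blast
  have "card B = CARD('k)"
    unfolding B(4) vec.dim_span[of "columns A", symmetric] span by (rule vec_dim_card)
  moreover have "finite B" using B(2) by (rule vec.finiteI_independent)
  ultimately obtain g where g: "bij_betw g (UNIV :: 'k set) B"
    using finite_same_card_bij[of "UNIV :: 'k set" B] by auto
  have "\<exists>j. g k = column j A" for k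
    using g B(1) by (auto simp: bij_betw_def columns_def)
  then obtain f where f: "g k = column (f k) A" for k by metis
  let ?M = "\<chi> i j. A $ i $ f j"
  have "columns ?M = B"
    using g f by (auto simp: columns_def column_def bij_betw_def)
  moreover have "vec.span B = UNIV"
    using vec.span_minimal[OF B(3) vec.subspace_span] span by auto
  ultimately have "\<exists>R. ?M ** R = mat 1"
    by (simp add: matrix_right_invertible_span_columns)
  then have "det ?M \<noteq> 0"
    by (simp add: invertible_right_inverse flip: invertible_det_nz)
  then show ?thesis using det_columns_eq_0[of f A] that[of f] by auto
qed

text \<open>Injectivity of the Pluecker embedding. It will show that a torus element scaling all
  nonzero minors alike fixes the subspace.\<close>

lemma row_space_eq_if_minors_proportional:
  fixes A B :: "complex^'n::{finite,linorder}^'k::{finite,linorder}"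
  assumes A: "A \<in> frames" and c: "c \<noteq> 0"
    and minors: "\<And>I. I \<in> k_subsets TYPE('k) \<Longrightarrow> minor B I = c * minor A I"
  shows "row_space B = row_space A"
proof -
  \<comment> \<open>Proportionality is extended to arbitrary column selections, because the
    selections \<open>f(k := j)\<close> in Cramer's rule may be unordered or have
    repetitions.\<close>
  have det: "det (\<chi> i j. B $ i $ f j) = c * det (\<chi> i j. A $ i $ f j)" for f :: "'k \<Rightarrow> 'n"
  proof (cases "inj f")
    case True
    obtain s where "\<And>A :: complex^'n::{finite,linorder}^'k::{finite,linorder}.
        det (\<chi> i j. A $ i $ f j) = s * minor A (range f)"
      using det_columns_eq_sign_minor[OF True] by blast
    moreover have "range f \<in> k_subsets TYPE('k)"
      using True by (simp add: k_subsets_def card_image)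
    ultimately show ?thesis by (simp add: minors)
  next
    case False
    then show ?thesis by (simp add: det_columns_eq_0)
  qed
  obtain f :: "'k \<Rightarrow> 'n" where f: "det (\<chi> i j. A $ i $ f j) \<noteq> 0"
    using frame_nonzero_minor[OF A] by blast
  \<comment> \<open>By Cramer's rule, the coordinates of the columns in the basis selected by \<open>f\<close> are ratios of minors,
    which do not change when all minors are multiplied by \<open>c\<close>.\<close>
  define S :: "complex^'n::{finite,linorder}^'k::{finite,linorder} \<Rightarrow>
      complex^'k::{finite,linorder}^'k::{finite,linorder}"
    where "S C = (\<chi> i j. C $ i $ f j)" for C
  define X :: "complex^'n::{finite,linorder}^'k::{finite,linorder}" where
    "X = (\<chi> k j. det (\<chi> i l. A $ i $ (f(k := j)) l) / det (S A))"
  have coordinates: "C = S C ** X" if C: "det (S C) \<noteq> 0"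
      and X: "X = (\<chi> k j. det (\<chi> i l. C $ i $ (f(k := j)) l) / det (S C))" for C
  proof -
    have "S C *v column j X = column j C" for j
    proof (subst cramer[OF C])
      show "column j X = (\<chi> k. det (\<chi> i l. if l = k then column j C $ i else S C $ i $ l) / det (S C))"
        by (simp add: X column_def S_def vec_eq_iff if_distrib cong: if_cong)
    qed
    then show ?thesis
      by (simp add: vec_eq_iff column_def matrix_vector_mult_def matrix_matrix_mult_def)
  qed
  have SA: "det (S A) \<noteq> 0" using f by (simp add: S_def)
  have SB: "det (S B) = c * det (S A)" unfolding S_def by (rule det)
  have "A = S A ** X" using SA X_def by (rule coordinates)
  moreover have "B = S B ** X"
  proof (rule coordinates)
    show "X = (\<chi> k j. det (\<chi> i l. B $ i $ (f(k := j)) l) / det (S B))"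
      unfolding X_def det[of "f(_ := _)"] SB using c by simp
  qed (use SB SA c in simp)
  \<comment> \<open>Both matrices are now invertible left multiples of the same
    \<open>X\<close>.\<close>
  moreover have "invertible (S A)" "invertible (S B)"
    using SA SB c by (simp_all add: invertible_det_nz)
  ultimately show ?thesis
    using row_space_invertible_mult[of "S A" X] row_space_invertible_mult[of "S B" X] by simp
qed


section \<open>Torus orbits\<close>

lemma torus_act_torus_act: "torus_act s (torus_act t L) = torus_act (\<chi> i. s $ i * t $ i) L"
  by (simp add: torus_act_def image_image vec_eq_iff mult.assoc)

lemma torus_act_one: "torus_act (\<chi> i. 1) L = L"
  by (simp add: torus_act_def)

lemma torus_orbit_torus_act:
  assumes "(\<lambda>s. \<chi> i. s $ i * t $ i) ` H = H"
  shows "torus_orbit H (torus_act t L) = torus_orbit H L"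
proof -
  have "torus_orbit H (torus_act t L) = (\<lambda>s. torus_act s L) ` (\<lambda>s. \<chi> i. s $ i * t $ i) ` H"
    by (simp add: torus_orbit_def torus_act_torus_act image_image)
  then show ?thesis by (simp add: assms torus_orbit_def)
qed

lemma algebraic_torus_mult:
  assumes "t \<in> algebraic_torus"
  shows "(\<lambda>s. \<chi> i. s $ i * t $ i) ` algebraic_torus = algebraic_torus"
proof
  show "algebraic_torus \<subseteq> (\<lambda>s. \<chi> i. s $ i * t $ i) ` algebraic_torus"
  proof
    fix u :: "complex^'a" assume "u \<in> algebraic_torus"
    with assms show "u \<in> (\<lambda>s. \<chi> i. s $ i * t $ i) ` algebraic_torus"
      by (intro image_eqI[of _ _ "\<chi> i. u $ i / t $ i"]) (simp_all add: algebraic_torus_def vec_eq_iff)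
  qed
qed (use assms in \<open>auto simp: algebraic_torus_def\<close>)

lemma compact_torus_mult:
  assumes "t \<in> compact_torus"
  shows "(\<lambda>s. \<chi> i. s $ i * t $ i) ` compact_torus = compact_torus"
proof
  have "t $ i \<noteq> 0" for i using assms by (auto simp: compact_torus_def dest: spec[of _ i])
  show "compact_torus \<subseteq> (\<lambda>s. \<chi> i. s $ i * t $ i) ` compact_torus"
  proof
    fix u :: "complex^'a" assume "u \<in> compact_torus"
    with assms \<open>\<And>i. t $ i \<noteq> 0\<close> show "u \<in> (\<lambda>s. \<chi> i. s $ i * t $ i) ` compact_torus"
      by (intro image_eqI[of _ _ "\<chi> i. u $ i / t $ i"])
        (simp_all add: compact_torus_def vec_eq_iff norm_divide)
  qed
qed (use assms in \<open>auto simp: compact_torus_def norm_mult\<close>)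

lemma compact_torus_subset: "compact_torus \<subseteq> algebraic_torus"
proof
  fix t :: "complex^'a" assume "t \<in> compact_torus"
  then have "cmod (t $ i) = 1" for i by (simp add: compact_torus_def)
  then have "t $ i \<noteq> 0" for i by (metis norm_zero zero_neq_one)
  then show "t \<in> algebraic_torus" by (simp add: algebraic_torus_def)
qed

lemma algebraic_torus_orbit_torus_act:
  "t \<in> algebraic_torus \<Longrightarrow> torus_orbit algebraic_torus (torus_act t L) = torus_orbit algebraic_torus L"
  by (rule torus_orbit_torus_act[OF algebraic_torus_mult])

lemma compact_torus_orbit_torus_act:
  "t \<in> compact_torus \<Longrightarrow> torus_orbit compact_torus (torus_act t L) = torus_orbit compact_torus L"
  by (rule torus_orbit_torus_act[OF compact_torus_mult])

lemma algebraic_torus_orbit_eqD: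
  assumes "torus_orbit algebraic_torus L = torus_orbit algebraic_torus L'"
  obtains t where "t \<in> algebraic_torus" "L' = torus_act t L"
proof -
  have "(\<chi> i. 1) \<in> algebraic_torus" by (simp add: algebraic_torus_def)
  then have "L' \<in> torus_orbit algebraic_torus L'"
    unfolding torus_orbit_def by (intro image_eqI[where x = "\<chi> i. 1"]) (simp_all add: torus_act_one)
  with assms show ?thesis using that by (auto simp: torus_orbit_def)
qed

lemma the_elem_image_constant:
  assumes "x \<in> A" "\<And>y. y \<in> A \<Longrightarrow> f y = c"
  shows "the_elem (f ` A) = c"
proof -
  have "f ` A = {c}" using assms by auto
  then show ?thesis by simp
qed


section \<open>Frames of a stratum and the moment map\<close>

text \<open>The frame picked by \<open>SOME\<close> is unknown, so its minors agree with those of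
  \<open>A\<close> only up to a scalar.\<close>

lemma pluecker_row_space:
  fixes A :: "complex^'n::{finite,linorder}^'k::{finite,linorder}"
  assumes "A \<in> frames"
  obtains c where "c \<noteq> 0" "\<And>I. pluecker TYPE('k) (row_space A) I = c * minor A I"
proof -
  define B where "B = (SOME B :: complex^'n::{finite,linorder}^'k::{finite,linorder}.
    B \<in> frames \<and> row_space B = row_space A)"
  have "B \<in> frames \<and> row_space B = row_space A"
    unfolding B_def by (rule someI[of _ A]) (simp add: assms)
  then obtain c where "c \<noteq> 0" "\<forall>I. minor B I = c * minor A I"
    using minor_row_space_eq[of B A] by blast
  then show ?thesis by (intro that[of c]) (simp_all add: pluecker_def B_def)
qed

text \<open>The space upstairs: the stratum and both orbit spaces are quotients of it, so continuity
  and openness can be checked on matrices.\<close>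

definition stratum_frames ::
  "'n set set \<Rightarrow> (complex^'n::{finite,linorder}^'k::{finite,linorder}) set" where
  "stratum_frames \<sigma> = {A \<in> frames. row_space A \<in> stratum TYPE('k) \<sigma>}"

lemma stratum_frames_iff:
  fixes A :: "complex^'n::{finite,linorder}^'k::{finite,linorder}"
  shows "A \<in> stratum_frames \<sigma> \<longleftrightarrow>
    A \<in> frames \<and> (\<forall>I\<in>k_subsets TYPE('k). minor A I \<noteq> 0 \<longleftrightarrow> I \<in> \<sigma>)"
proof (cases "A \<in> frames")
  case True
  obtain c where "c \<noteq> 0" "\<And>I. pluecker TYPE('k) (row_space A) I = c * minor A I"
    using pluecker_row_space[OF True] by blast
  with True show ?thesis
    by (simp add: stratum_frames_def stratum_def row_space_frame_in_grassmannian)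
qed (simp add: stratum_frames_def)

lemma row_space_stratum_frames:
  "row_space ` (stratum_frames \<sigma> :: (complex^'n::{finite,linorder}^'k::{finite,linorder}) set)
    = stratum TYPE('k) \<sigma>"
proof
  show "stratum TYPE('k) \<sigma> \<subseteq>
    row_space ` (stratum_frames \<sigma> :: (complex^'n::{finite,linorder}^'k::{finite,linorder}) set)"
  proof
    fix L :: "(complex^'n::{finite,linorder}) set" assume L: "L \<in> stratum TYPE('k) \<sigma>"
    then have "L \<in> grassmannian TYPE('k)" by (simp add: stratum_def)
    then obtain A :: "complex^'n::{finite,linorder}^'k::{finite,linorder}" where "A \<in> frames" "row_space A = L"
      using row_space_frame_exists by blast
    with L show "L \<in> row_space ` (stratum_frames \<sigma> :: (complex^'n::{finite,linorder}^'k::{finite,linorder}) set)"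
      by (intro image_eqI[of _ _ A]) (simp_all add: stratum_frames_def)
  qed
qed (auto simp: stratum_frames_def)

lemma invertible_mult_in_stratum_frames:
  fixes A :: "complex^'n::{finite,linorder}^'k::{finite,linorder}"
    and M :: "complex^'k::{finite,linorder}^'k::{finite,linorder}"
  assumes "A \<in> stratum_frames \<sigma>" "invertible M"
  shows "M ** A \<in> stratum_frames \<sigma>"
  using assms by (simp add: stratum_frames_def invertible_mult_in_frames row_space_invertible_mult)

lemma col_scale_in_stratum_frames:
  assumes "A \<in> stratum_frames \<sigma>" "t \<in> algebraic_torus"
  shows "col_scale t A \<in> stratum_frames \<sigma>"
  using assms
  by (auto simp: stratum_frames_iff col_scale_in_frames minor_col_scale k_subsets_def algebraic_torus_def)

definition minor_weight ::
  "complex^'n::{finite,linorder}^'k::{finite,linorder} \<Rightarrow> 'n set \<Rightarrow> real" where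
  "minor_weight A I = (cmod (minor A I))\<^sup>2"

text \<open>The scalar relating Pluecker coordinates to minors cancels in the quotient, and the
  minors outside \<open>\<sigma>\<close> vanish.\<close>

lemma moment_map_row_space:
  fixes A :: "complex^'n::{finite,linorder}^'k::{finite,linorder}"
  assumes \<sigma>: "\<sigma> \<subseteq> k_subsets TYPE('k)" and A: "A \<in> stratum_frames \<sigma>"
  shows "moment_map TYPE('k) (row_space A) =
    (1 / (\<Sum>I\<in>\<sigma>. minor_weight A I)) *\<^sub>R (\<Sum>I\<in>\<sigma>. minor_weight A I *\<^sub>R Lambda I)"
proof -
  have frame: "A \<in> frames" using A by (simp add: stratum_frames_iff)
  obtain c where c: "c \<noteq> 0" "\<And>I. pluecker TYPE('k) (row_space A) I = c * minor A I"
    using pluecker_row_space[OF frame] by blast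
  have 0: "minor_weight A I = 0" if "I \<in> k_subsets TYPE('k) - \<sigma>" for I
    using A that by (auto simp: stratum_frames_iff minor_weight_def)
  have pl: "(cmod (pluecker TYPE('k) (row_space A) I))\<^sup>2 = (cmod c)\<^sup>2 * minor_weight A I" for I
    by (simp add: c minor_weight_def norm_mult power_mult_distrib)
  have 1: "(\<Sum>I\<in>k_subsets TYPE('k). (cmod (pluecker TYPE('k) (row_space A) I))\<^sup>2)
      = (cmod c)\<^sup>2 * (\<Sum>I\<in>\<sigma>. minor_weight A I)"
    unfolding pl sum_distrib_left by (rule sum.mono_neutral_right) (use \<sigma> 0 in auto)
  have 2: "(\<Sum>I\<in>k_subsets TYPE('k). (cmod (pluecker TYPE('k) (row_space A) I))\<^sup>2 *\<^sub>R Lambda I)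
      = (cmod c)\<^sup>2 *\<^sub>R (\<Sum>I\<in>\<sigma>. minor_weight A I *\<^sub>R (Lambda I :: real^'n::{finite,linorder}))"
    unfolding pl scaleR_sum_right scaleR_scaleR
    by (rule sum.mono_neutral_right) (use \<sigma> 0 in auto)
  show ?thesis unfolding moment_map_def 1 2 using c(1) by simp
qed

lemma minor_weight_pos:
  fixes A :: "complex^'n::{finite,linorder}^'k::{finite,linorder}"
  assumes "\<sigma> \<subseteq> k_subsets TYPE('k)" "A \<in> stratum_frames \<sigma>" "I \<in> \<sigma>"
  shows "0 < minor_weight A I"
  using assms by (auto simp: stratum_frames_iff minor_weight_def)

lemma sum_minor_weight_pos:
  fixes A :: "complex^'n::{finite,linorder}^'k::{finite,linorder}"
  assumes \<sigma>: "\<sigma> \<subseteq> k_subsets TYPE('k)" and A: "A \<in> stratum_frames \<sigma>"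
  shows "0 < (\<Sum>I\<in>\<sigma>. minor_weight A I)"
proof -
  have "A \<in> frames" using A by (simp add: stratum_frames_iff)
  then obtain f :: "'k \<Rightarrow> 'n" where f: "inj f" "det (\<chi> i j. A $ i $ f j) \<noteq> 0"
    using frame_nonzero_minor by blast
  obtain s where "\<And>A :: complex^'n::{finite,linorder}^'k::{finite,linorder}.
      det (\<chi> i j. A $ i $ f j) = s * minor A (range f)"
    using det_columns_eq_sign_minor[OF f(1)] by blast
  with f(2) have "minor A (range f) \<noteq> 0" by auto
  moreover have "range f \<in> k_subsets TYPE('k)"
    using f(1) by (simp add: k_subsets_def card_image)
  ultimately have "range f \<in> \<sigma>" using A by (auto simp: stratum_frames_iff)
  then show ?thesis
    using minor_weight_pos[OF \<sigma> A] by (intro sum_pos) auto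
qed

text \<open>Clearing the positive denominator makes the condition linear in the weights, the form
  used for critical points.\<close>

lemma moment_map_eq_iff:
  fixes A :: "complex^'n::{finite,linorder}^'k::{finite,linorder}"
  assumes \<sigma>: "\<sigma> \<subseteq> k_subsets TYPE('k)" and A: "A \<in> stratum_frames \<sigma>"
  shows "moment_map TYPE('k) (row_space A) = x \<longleftrightarrow>
    (\<Sum>I\<in>\<sigma>. minor_weight A I *\<^sub>R (Lambda I - x)) = 0"
proof -
  let ?W = "\<Sum>I\<in>\<sigma>. minor_weight A I"
  have W: "?W > 0" by (rule sum_minor_weight_pos[OF \<sigma> A])
  have "(1 / ?W) *\<^sub>R v = x \<longleftrightarrow> v = ?W *\<^sub>R x" for v :: "real^'n::{finite,linorder}"
    using W by (auto simp: field_simps)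
  then have "moment_map TYPE('k) (row_space A) = x \<longleftrightarrow>
      (\<Sum>I\<in>\<sigma>. minor_weight A I *\<^sub>R Lambda I) = ?W *\<^sub>R x"
    by (simp only: moment_map_row_space[OF \<sigma> A])
  then show ?thesis by (simp add: scaleR_diff_right sum_subtractf scaleR_sum_left)
qed

section \<open>The positive real part of the torus\<close>

text \<open>The exponent is halved because the weights are squares of absolute values.\<close>

definition exp_torus :: "real^'n \<Rightarrow> complex^'n" where
  "exp_torus s = (\<chi> i. of_real (exp (s $ i / 2)))"

lemma exp_torus_in_algebraic_torus: "exp_torus s \<in> algebraic_torus"
  by (simp add: exp_torus_def algebraic_torus_def)

lemma inner_Lambda: "Lambda I \<bullet> s = (\<Sum>i\<in>I. s $ i)"
  by (simp add: Lambda_def inner_vec_def if_distrib[of "\<lambda>a. a * _"] sum.If_cases cong: if_cong)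

lemma minor_exp_torus:
  fixes A :: "complex^'n::{finite,linorder}^'k::{finite,linorder}"
  assumes "I \<in> k_subsets TYPE('k)"
  shows "minor (col_scale (exp_torus s) A) I = of_real (exp (Lambda I \<bullet> s / 2)) * minor A I"
  using assms
  by (simp add: minor_col_scale k_subsets_def exp_torus_def inner_Lambda exp_sum sum_divide_distrib)

lemma minor_weight_exp_torus:
  fixes A :: "complex^'n::{finite,linorder}^'k::{finite,linorder}"
  assumes "I \<in> k_subsets TYPE('k)"
  shows "minor_weight (col_scale (exp_torus s) A) I = minor_weight A I * exp (Lambda I \<bullet> s)"
  by (simp add: minor_weight_def minor_exp_torus[OF assms] norm_mult power_mult_distrib
      flip: exp_double)

lemma moment_map_exp_torus_eq_iff:
  fixes A :: "complex^'n::{finite,linorder}^'k::{finite,linorder}"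
  assumes \<sigma>: "\<sigma> \<subseteq> k_subsets TYPE('k)" and A: "A \<in> stratum_frames \<sigma>"
  shows "moment_map TYPE('k) (row_space (col_scale (exp_torus s) A)) = x \<longleftrightarrow>
    (\<Sum>I\<in>\<sigma>. (minor_weight A I * exp (Lambda I \<bullet> s)) *\<^sub>R (Lambda I - x)) = 0"
proof -
  have "(\<Sum>I\<in>\<sigma>. minor_weight (col_scale (exp_torus s) A) I *\<^sub>R (Lambda I - x))
      = (\<Sum>I\<in>\<sigma>. (minor_weight A I * exp (Lambda I \<bullet> s)) *\<^sub>R (Lambda I - x))"
    using \<sigma> by (intro sum.cong) (auto simp: minor_weight_exp_torus)
  then show ?thesis
    by (simp add: moment_map_eq_iff[OF \<sigma> col_scale_in_stratum_frames[OF A exp_torus_in_algebraic_torus]])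
qed

lemma moment_map_compact_torus:
  fixes A :: "complex^'n::{finite,linorder}^'k::{finite,linorder}"
  assumes \<sigma>: "\<sigma> \<subseteq> k_subsets TYPE('k)" and A: "A \<in> stratum_frames \<sigma>" and t: "t \<in> compact_torus"
  shows "moment_map TYPE('k) (torus_act t (row_space A)) = moment_map TYPE('k) (row_space A)"
proof -
  have "minor_weight (col_scale t A) I = minor_weight A I" if "I \<in> \<sigma>" for I
  proof -
    have "card I = CARD('k)" using \<sigma> that by (auto simp: k_subsets_def)
    moreover have "(\<Prod>i\<in>I. cmod (t $ i)) = 1" using t by (simp add: compact_torus_def)
    ultimately show ?thesis
      by (simp add: minor_weight_def minor_col_scale norm_mult flip: prod_norm)
  qed
  moreover have "col_scale t A \<in> stratum_frames \<sigma>"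
    using A t compact_torus_subset by (intro col_scale_in_stratum_frames) auto
  ultimately show ?thesis
    by (simp add: torus_act_row_space moment_map_row_space[OF \<sigma>] A)
qed

text \<open>The description of the relative interior of the hull of a union of convex sets, applied
  to singletons, each of which is its own relative interior.\<close>

lemma rel_interior_polytope_of:
  fixes \<sigma> :: "'n::finite set set"
  shows "rel_interior (polytope_of \<sigma>) =
    {\<Sum>I\<in>\<sigma>. c I *\<^sub>R Lambda I | c. (\<forall>I\<in>\<sigma>. 0 < c I) \<and> sum c \<sigma> = 1}"
proof -
  have "(\<Union>I\<in>\<sigma>. {Lambda I :: real^'n}) = Lambda ` \<sigma>" by auto
  with rel_interior_convex_hull_union[of \<sigma> "\<lambda>I. {Lambda I :: real^'n}"]
  have "rel_interior (polytope_of \<sigma>) =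
      {\<Sum>I\<in>\<sigma>. c I *\<^sub>R s I | c s. (\<forall>I\<in>\<sigma>. 0 < c I) \<and> sum c \<sigma> = 1 \<and> (\<forall>I\<in>\<sigma>. s I = Lambda I)}"
    by (simp add: polytope_of_def)
  also have "\<dots> = {\<Sum>I\<in>\<sigma>. c I *\<^sub>R Lambda I | c. (\<forall>I\<in>\<sigma>. 0 < c I) \<and> sum c \<sigma> = 1}"
    by (intro Collect_cong) (metis (no_types, lifting) sum.cong)
  finally show ?thesis .
qed

lemma moment_map_in_rel_interior:
  fixes A :: "complex^'n::{finite,linorder}^'k::{finite,linorder}"
  assumes \<sigma>: "\<sigma> \<subseteq> k_subsets TYPE('k)" and A: "A \<in> stratum_frames \<sigma>"
  shows "moment_map TYPE('k) (row_space A) \<in> rel_interior (polytope_of \<sigma>)"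
proof -
  let ?W = "\<Sum>I\<in>\<sigma>. minor_weight A I"
  have W: "?W > 0" by (rule sum_minor_weight_pos[OF \<sigma> A])
  have "moment_map TYPE('k) (row_space A) = (\<Sum>I\<in>\<sigma>. (minor_weight A I / ?W) *\<^sub>R Lambda I)"
    by (simp add: moment_map_row_space[OF \<sigma> A] scaleR_sum_right)
  moreover have "(\<Sum>I\<in>\<sigma>. minor_weight A I / ?W) = 1"
    using W by (simp flip: sum_divide_distrib)
  ultimately show ?thesis
    unfolding rel_interior_polytope_of
    using minor_weight_pos[OF \<sigma> A] W
    by (intro CollectI exI[of _ "\<lambda>I. minor_weight A I / ?W"]) simp
qed

lemma continuous_on_minor:
  fixes f :: "'a::topological_space \<Rightarrow> complex^'n::{finite,linorder}^'k::{finite,linorder}"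
  assumes "continuous_on S f"
  shows "continuous_on S (\<lambda>x. minor (f x) I)"
  unfolding minor_def det_def by (simp, intro continuous_intros assms)

lemma continuous_on_matrix_mult_right:
  "continuous_on S (\<lambda>A :: complex^'n^'k. M ** A)"
  unfolding matrix_matrix_mult_def by (intro continuous_intros)

lemma continuous_on_col_scale:
  fixes f :: "'a::topological_space \<Rightarrow> complex^'n" and g :: "'a \<Rightarrow> complex^'n^'k"
  assumes "continuous_on S f" "continuous_on S g"
  shows "continuous_on S (\<lambda>x. col_scale (f x) (g x))"
  unfolding col_scale_def by (intro continuous_intros assms)


section \<open>Quotient topologies and openness\<close>

text \<open>It suffices that the saturation of an open \<open>U\<close> is open. If \<open>y\<close>
  lies in the fibre of some \<open>x \<in> U\<close>, a fibre-preserving map \<open>\<phi>\<close>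
  with \<open>\<phi> y = x\<close> pulls \<open>U\<close> back to a neighbourhood of
  \<open>y\<close> inside the saturation.\<close>

lemma open_map_if_fibres_homogeneous:
  assumes q: "quotient_map X Y f"
    and fibres: "\<And>x y. x \<in> topspace X \<Longrightarrow> y \<in> topspace X \<Longrightarrow> f x = f y \<Longrightarrow>
      \<exists>\<phi>. continuous_map X X \<phi> \<and> \<phi> y = x \<and> (\<forall>z\<in>topspace X. f (\<phi> z) = f z)"
  shows "open_map X Y f"
  unfolding open_map_def
proof (intro allI impI)
  fix U assume U: "openin X U"
  have sub: "U \<subseteq> topspace X" using U by (rule openin_subset)
  have "openin X {y \<in> topspace X. f y \<in> f ` U}"
  proof (subst openin_subopen, intro ballI)
    fix y assume "y \<in> {y \<in> topspace X. f y \<in> f ` U}"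
    then obtain x where y: "y \<in> topspace X" and x: "x \<in> U" "f x = f y" by force
    with fibres[of x y] sub obtain \<phi>
      where \<phi>: "continuous_map X X \<phi>" "\<phi> y = x" "\<And>z. z \<in> topspace X \<Longrightarrow> f (\<phi> z) = f z"
      by blast
    have "openin X {z \<in> topspace X. \<phi> z \<in> U}"
      using \<phi>(1) U by (rule openin_continuous_map_preimage)
    moreover have "y \<in> {z \<in> topspace X. \<phi> z \<in> U}" using y x \<phi>(2) by simp
    moreover have "{z \<in> topspace X. \<phi> z \<in> U} \<subseteq> {y \<in> topspace X. f y \<in> f ` U}"
    proof clarify
      fix z assume "z \<in> topspace X" "\<phi> z \<in> U"
      then show "f z \<in> f ` U" using \<phi>(3)[of z] by (intro image_eqI[of _ _ "\<phi> z"]) simp_all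
    qed
    ultimately show "\<exists>T. openin X T \<and> y \<in> T \<and> T \<subseteq> {y \<in> topspace X. f y \<in> f ` U}" by blast
  qed
  moreover have "f ` U \<subseteq> topspace Y"
    using sub quotient_imp_surjective_map[OF q] by blast
  ultimately show "openin Y (f ` U)"
    using q by (simp add: quotient_map_def)
qed

lemma continuous_map_self_top_of_set:
  assumes "continuous_on S f" "\<And>x. x \<in> S \<Longrightarrow> f x \<in> S"
  shows "continuous_map (top_of_set S) (top_of_set S) f"
  using assms by (simp add: image_subset_iff_funcset[symmetric] image_subset_iff)

text \<open>Frames in one fibre differ by an invertible left factor, and multiplication by it
  preserves all row spaces.\<close>

lemma open_map_row_space:
  "open_map (top_of_set (frames :: (complex^'n^'k) set)) (grassmannian_topology TYPE('k)) row_space"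
  unfolding grassmannian_topology_def
proof (rule open_map_if_fibres_homogeneous[OF quotient_map_quotient_topology])
  fix A B :: "complex^'n^'k"
  assume "A \<in> topspace (top_of_set frames)" "row_space A = row_space B"
  then have "A \<in> frames" "row_space A = row_space B" by simp_all
  then obtain M :: "complex^'k^'k" where M: "invertible M" "A = M ** B"
    by (rule frames_row_space_eq)
  have "continuous_map (top_of_set frames) (top_of_set frames) (\<lambda>C :: complex^'n^'k. M ** C)"
    by (intro continuous_map_self_top_of_set continuous_on_matrix_mult_right
        invertible_mult_in_frames M)
  then show "\<exists>\<phi>. continuous_map (top_of_set frames) (top_of_set frames) \<phi> \<and> \<phi> B = A \<and>
      (\<forall>C\<in>topspace (top_of_set frames). row_space (\<phi> C) = row_space C)"
    using M by (auto simp: row_space_invertible_mult)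
qed

text \<open>A quotient map may fail to remain one over a subspace, but an open map stays open over
  it; hence the detour through \<open>open_map_row_space\<close>.\<close>

lemma quotient_map_stratum_frames:
  "quotient_map
     (top_of_set (stratum_frames \<sigma> :: (complex^'n::{finite,linorder}^'k::{finite,linorder}) set))
     (stratum_topology TYPE('k) \<sigma>) row_space"
proof -
  let ?F = "frames :: (complex^'n::{finite,linorder}^'k::{finite,linorder}) set"
  let ?S = "stratum_frames \<sigma> :: (complex^'n::{finite,linorder}^'k::{finite,linorder}) set"
  have sub: "?S \<subseteq> ?F" by (auto simp: stratum_frames_def)
  have S: "top_of_set ?S = subtopology (top_of_set ?F) ?S"
    using sub by (simp add: subtopology_subtopology inf.absorb2)
  have "continuous_map (top_of_set ?F) (grassmannian_topology TYPE('k)) row_space"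
    unfolding grassmannian_topology_def
    by (rule quotient_imp_continuous_map[OF quotient_map_quotient_topology])
  then have "continuous_map (top_of_set ?S) (grassmannian_topology TYPE('k)) row_space"
    unfolding S by (rule continuous_map_from_subtopology)
  then have "continuous_map (top_of_set ?S) (stratum_topology TYPE('k) \<sigma>) row_space"
    unfolding stratum_topology_def
    by (rule continuous_map_into_subtopology) (auto simp: stratum_frames_def)
  moreover have "open_map (top_of_set ?S) (stratum_topology TYPE('k) \<sigma>) row_space"
    unfolding S stratum_topology_def
    by (rule open_map_restriction[OF open_map_row_space]) (auto simp: stratum_frames_def)
  moreover have "topspace (stratum_topology TYPE('k) \<sigma>) =
      (stratum TYPE('k) \<sigma> :: (complex^'n::{finite,linorder}) set set)"
    by (auto simp: stratum_topology_def topspace_grassmannian stratum_def)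
  ultimately show ?thesis
    by (intro continuous_open_imp_quotient_map) (simp_all add: row_space_stratum_frames)
qed

lemma quotient_map_orbit_space:
  "quotient_map
     (top_of_set (stratum_frames \<sigma> :: (complex^'n::{finite,linorder}^'k::{finite,linorder}) set))
     (orbit_space H (stratum_topology TYPE('k) \<sigma>)) (\<lambda>A. torus_orbit H (row_space A))"
  using quotient_map_compose[OF quotient_map_stratum_frames quotient_map_quotient_topology]
  by (simp add: orbit_space_def comp_def)

text \<open>Frames over the same orbit are related by a column scaling followed by an invertible
  left factor; the same operation on all frames preserves every orbit.\<close>

lemma open_map_algebraic_torus_orbit:
  "open_map
     (top_of_set (stratum_frames \<sigma> :: (complex^'n::{finite,linorder}^'k::{finite,linorder}) set))
     (F_space TYPE('k) \<sigma>) (\<lambda>A. torus_orbit algebraic_torus (row_space A))"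
  unfolding F_space_def
proof (rule open_map_if_fibres_homogeneous[OF quotient_map_orbit_space])
  let ?S = "stratum_frames \<sigma> :: (complex^'n::{finite,linorder}^'k::{finite,linorder}) set"
  fix A B :: "complex^'n::{finite,linorder}^'k::{finite,linorder}"
  assume A: "A \<in> topspace (top_of_set ?S)" and B: "B \<in> topspace (top_of_set ?S)"
    and eq: "torus_orbit algebraic_torus (row_space A) = torus_orbit algebraic_torus (row_space B)"
  obtain t where t: "t \<in> algebraic_torus" "row_space A = row_space (col_scale t B)"
    using algebraic_torus_orbit_eqD[OF eq[symmetric]] by (auto simp: torus_act_row_space)
  have "A \<in> frames" using A by (simp add: stratum_frames_def)
  then obtain M :: "complex^'k::{finite,linorder}^'k::{finite,linorder}"
    where M: "invertible M" "A = M ** col_scale t B"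
    using frames_row_space_eq[OF _ t(2)] by blast
  let ?\<phi> = "\<lambda>C. M ** col_scale t C"
  have "continuous_on ?S ?\<phi>"
    by (intro continuous_on_compose2[OF continuous_on_matrix_mult_right[of UNIV]]
        continuous_on_col_scale continuous_intros) auto
  then have "continuous_map (top_of_set ?S) (top_of_set ?S) ?\<phi>"
    by (rule continuous_map_self_top_of_set)
      (intro invertible_mult_in_stratum_frames col_scale_in_stratum_frames M t)
  moreover have "torus_orbit algebraic_torus (row_space (?\<phi> C)) = torus_orbit algebraic_torus (row_space C)" for C
    using algebraic_torus_orbit_torus_act[OF t(1), of "row_space C"]
    by (simp add: row_space_invertible_mult M(1) torus_act_row_space)
  ultimately show "\<exists>\<phi>. continuous_map (top_of_set ?S) (top_of_set ?S) \<phi> \<and> \<phi> B = A \<and>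
      (\<forall>C\<in>topspace (top_of_set ?S).
        torus_orbit algebraic_torus (row_space (\<phi> C)) = torus_orbit algebraic_torus (row_space C))"
    using M(2) by (intro exI[of _ ?\<phi>]) simp
qed

lemma continuous_on_moment_map:
  fixes \<sigma> :: "'n::{finite,linorder} set set"
  assumes \<sigma>: "\<sigma> \<subseteq> k_subsets TYPE('k::{finite,linorder})"
  shows "continuous_on (stratum_frames \<sigma> :: (complex^'n::{finite,linorder}^'k::{finite,linorder}) set)
    (\<lambda>A. moment_map TYPE('k) (row_space A))"
proof -
  let ?S = "stratum_frames \<sigma> :: (complex^'n::{finite,linorder}^'k::{finite,linorder}) set"
  have "continuous_on ?S (\<lambda>A. minor_weight A I)" for I
    unfolding minor_weight_def by (intro continuous_intros continuous_on_minor)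
  moreover have "(\<Sum>I\<in>\<sigma>. minor_weight A I) \<noteq> 0" if "A \<in> ?S" for A
    using sum_minor_weight_pos[OF \<sigma> that] by simp
  ultimately have "continuous_on ?S (\<lambda>A. (1 / (\<Sum>I\<in>\<sigma>. minor_weight A I)) *\<^sub>R
      (\<Sum>I\<in>\<sigma>. minor_weight A I *\<^sub>R (Lambda I :: real^'n::{finite,linorder})))"
    by (intro continuous_intros) auto
  then show ?thesis
    by (simp cong: continuous_on_cong add: moment_map_row_space[OF \<sigma>])
qed

section \<open>Prescribing the moment within a torus orbit\<close>

text \<open>Since \<open>x\<close> is an affine combination of the vertices, every
  \<open>Lambda I - x\<close> lies in the direction space, so the critical point theorem applies
  there.\<close>

lemma moment_map_solution:
  fixes A :: "complex^'n::{finite,linorder}^'k::{finite,linorder}"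
  assumes \<sigma>: "\<sigma> \<subseteq> k_subsets TYPE('k)" and A: "A \<in> stratum_frames \<sigma>"
    and x: "x \<in> rel_interior (polytope_of \<sigma>)" and e: "0 < e"
    and sphere: "\<And>s. s \<in> direction_space \<sigma> Lambda \<Longrightarrow> norm s = e \<Longrightarrow>
      expsum \<sigma> Lambda (minor_weight A) x 0 < expsum \<sigma> Lambda (minor_weight A) x s"
  obtains s where "norm s < e" "moment_map TYPE('k) (row_space (col_scale (exp_torus s) A)) = x"
proof -
  obtain c where c: "sum c \<sigma> = 1" "x = (\<Sum>I\<in>\<sigma>. c I *\<^sub>R Lambda I)"
    using x unfolding rel_interior_polytope_of by blast
  have mem: "Lambda I - x \<in> direction_space \<sigma> Lambda" if "I \<in> \<sigma>" for I
    unfolding c(2) by (rule diff_mem_direction_space) (use that c(1) in auto)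
  have "subspace (direction_space \<sigma> (Lambda :: _ \<Rightarrow> real^'n::{finite,linorder}))"
    by (simp add: direction_space_def)
  from exponential_weights_critical_point[OF finite this mem less_imp_le[OF e] sphere]
  obtain s where s: "norm s < e"
      "(\<Sum>I\<in>\<sigma>. (minor_weight A I * exp (Lambda I \<bullet> s)) *\<^sub>R Lambda I) =
       (\<Sum>I\<in>\<sigma>. minor_weight A I * exp (Lambda I \<bullet> s)) *\<^sub>R x"
    by blast
  have "moment_map TYPE('k) (row_space (col_scale (exp_torus s) A)) = x"
    unfolding moment_map_exp_torus_eq_iff[OF \<sigma> A]
    using s(2) by (simp add: scaleR_diff_right sum_subtractf scaleR_sum_left)
  with s(1) show ?thesis by (rule that)
qed

lemma moment_map_surjective_on_orbit:
  fixes A :: "complex^'n::{finite,linorder}^'k::{finite,linorder}"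
  assumes \<sigma>: "\<sigma> \<subseteq> k_subsets TYPE('k)" and A: "A \<in> stratum_frames \<sigma>"
    and x: "x \<in> rel_interior (polytope_of \<sigma>)"
  obtains s where "moment_map TYPE('k) (row_space (col_scale (exp_torus s) A)) = x"
proof -
  obtain c where c: "\<And>I. I \<in> \<sigma> \<Longrightarrow> 0 < c I" "sum c \<sigma> = 1" "x = (\<Sum>I\<in>\<sigma>. c I *\<^sub>R Lambda I)"
    using x unfolding rel_interior_polytope_of by blast
  have "(\<Sum>I\<in>\<sigma>. c I *\<^sub>R (Lambda I - x)) = 0"
    using c(2,3) by (simp add: scaleR_diff_right sum_subtractf flip: scaleR_sum_left)
  from expsum_gt_on_large_sphere[of \<sigma> "minor_weight A", OF finite minor_weight_pos[OF \<sigma> A] c(1) this]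
  obtain R where "0 < R" "\<And>s. s \<in> direction_space \<sigma> Lambda \<Longrightarrow> norm s = R \<Longrightarrow>
      expsum \<sigma> Lambda (minor_weight A) x 0 < expsum \<sigma> Lambda (minor_weight A) x s"
    by blast
  then show ?thesis
    using moment_map_solution[OF \<sigma> A x, of R] that by blast
qed

text \<open>Equal moments force \<open>Lambda I \<bullet> s\<close> to be the same for all
  \<open>I \<in> \<sigma>\<close>, so \<open>exp_torus s\<close> multiplies all minors by one
  scalar; those outside \<open>\<sigma>\<close> are zero anyway.\<close>

lemma moment_map_injective_on_orbit:
  fixes A :: "complex^'n::{finite,linorder}^'k::{finite,linorder}"
  assumes \<sigma>: "\<sigma> \<subseteq> k_subsets TYPE('k)" and A: "A \<in> stratum_frames \<sigma>"
    and eq: "moment_map TYPE('k) (row_space (col_scale (exp_torus s) A)) = moment_map TYPE('k) (row_space A)"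
  shows "row_space (col_scale (exp_torus s) A) = row_space A"
proof -
  define x where "x = moment_map TYPE('k) (row_space A)"
  have mean: "(\<Sum>I\<in>\<sigma>. minor_weight A I *\<^sub>R (Lambda I - x)) = 0"
    using moment_map_eq_iff[OF \<sigma> A, of x] by (simp add: x_def)
  have mean': "(\<Sum>I\<in>\<sigma>. (minor_weight A I * exp (Lambda I \<bullet> s)) *\<^sub>R (Lambda I - x)) = 0"
    using moment_map_exp_torus_eq_iff[OF \<sigma> A, of s x] eq by (simp add: x_def)
  have inner: "Lambda I \<bullet> s = x \<bullet> s" if "I \<in> \<sigma>" for I
    using exponential_weights_mean_unique[OF _ _ mean mean' that] minor_weight_pos[OF \<sigma> A] by simp
  show ?thesis
  proof (rule row_space_eq_if_minors_proportional)
    show "A \<in> frames" using A by (simp add: stratum_frames_def)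
    fix I :: "'n set" assume I: "I \<in> k_subsets TYPE('k)"
    show "minor (col_scale (exp_torus s) A) I = of_real (exp (x \<bullet> s / 2)) * minor A I"
    proof (cases "I \<in> \<sigma>")
      case True
      then show ?thesis by (simp add: minor_exp_torus[OF I] inner)
    next
      case False
      then have "minor A I = 0" using A I by (auto simp: stratum_frames_iff)
      then show ?thesis by (simp add: minor_exp_torus[OF I])
    qed
  qed simp
qed

text \<open>The local statement behind openness. The radius \<open>e\<close> is fixed first, so that
  scalings of norm below \<open>e\<close> keep frames near \<open>A0\<close> inside
  \<open>U\<close>; only then are \<open>A\<close> and \<open>x\<close> restricted so that the
  sphere inequality of radius \<open>e\<close> survives.\<close>

lemma moment_map_solution_nearby:
  fixes A0 :: "complex^'n::{finite,linorder}^'k::{finite,linorder}"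
  assumes \<sigma>: "\<sigma> \<subseteq> k_subsets TYPE('k)" and A0: "A0 \<in> U"
    and U: "openin (top_of_set (stratum_frames \<sigma>)) U"
  obtains N V where "openin (top_of_set (stratum_frames \<sigma>)) N" "A0 \<in> N"
    "open V" "moment_map TYPE('k) (row_space A0) \<in> V"
    "\<And>A x. A \<in> N \<Longrightarrow> x \<in> V \<Longrightarrow> x \<in> rel_interior (polytope_of \<sigma>) \<Longrightarrow>
      \<exists>s. col_scale (exp_torus s) A \<in> U \<and>
        moment_map TYPE('k) (row_space (col_scale (exp_torus s) A)) = x"
proof -
  let ?S = "stratum_frames \<sigma> :: (complex^'n::{finite,linorder}^'k::{finite,linorder}) set"
  let ?x0 = "moment_map TYPE('k) (row_space A0)"
  obtain O' where O': "open O'" "U = ?S \<inter> O'" using U by (auto simp: openin_open)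
  have A0S: "A0 \<in> ?S" using A0 O'(2) by simp
  \<comment> \<open>Joint continuity at \<open>(0, A0)\<close> yields the radius \<open>e\<close>
    and the neighbourhood \<open>T\<close> together.\<close>
  define g where "g = (\<lambda>(s, A :: complex^'n::{finite,linorder}^'k::{finite,linorder}). col_scale (exp_torus s) A)"
  have "continuous_on UNIV g"
    unfolding g_def exp_torus_def case_prod_unfold
    by (intro continuous_on_col_scale continuous_intros) auto
  then have "open (g -` O')" using O'(1) by (rule open_vimage[rotated])
  moreover have "(0, A0) \<in> g -` O'"
    using A0 O'(2) col_scale_one[of A0] by (simp add: g_def exp_torus_def)
  ultimately obtain B T where B: "open B" "0 \<in> B" and T: "open T" "A0 \<in> T" and BT: "B \<times> T \<subseteq> g -` O'"
    by (rule open_prod_elim) auto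
  obtain e where e: "0 < e" "ball 0 e \<subseteq> B" using B openE by blast
  define a where "a A = (\<chi> I. minor_weight A I)" for A :: "complex^'n::{finite,linorder}^'k::{finite,linorder}"
  have a: "(($) (a A)) = minor_weight A" for A by (simp add: a_def fun_eq_iff)
  have gt: "expsum \<sigma> Lambda (($) (a A0)) ?x0 0 < expsum \<sigma> Lambda (($) (a A0)) ?x0 s"
    if "s \<in> direction_space \<sigma> Lambda" "norm s = e" for s
    unfolding a
  proof (rule expsum_gt_at_mean)
    show "(\<Sum>I\<in>\<sigma>. minor_weight A0 I *\<^sub>R (Lambda I - ?x0)) = 0"
      using moment_map_eq_iff[OF \<sigma> A0S, of ?x0] by simp
    show "s \<noteq> 0" using that(2) e(1) by auto
  qed (use that minor_weight_pos[OF \<sigma> A0S] in auto)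
  have "subspace (direction_space \<sigma> (Lambda :: _ \<Rightarrow> real^'n::{finite,linorder}))"
    by (simp add: direction_space_def)
  from expsum_gt_on_sphere_open[OF gt this]
  obtain Y where Y: "open Y" "(a A0, ?x0) \<in> Y"
    "\<And>b x s. (b, x) \<in> Y \<Longrightarrow> s \<in> direction_space \<sigma> Lambda \<Longrightarrow> norm s = e \<Longrightarrow>
      expsum \<sigma> Lambda (($) b) x 0 < expsum \<sigma> Lambda (($) b) x s" by blast
  from Y(1,2) obtain P V where P: "open P" "a A0 \<in> P" and V: "open V" "?x0 \<in> V" and PV: "P \<times> V \<subseteq> Y"
    by (rule open_prod_elim) auto
  have "continuous_on UNIV a"
    unfolding a_def minor_weight_def by (intro continuous_intros continuous_on_minor)
  then have "open (T \<inter> a -` P)" using P(1) T(1) by (intro open_Int open_vimage)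
  then have "openin (top_of_set ?S) (?S \<inter> (T \<inter> a -` P))" by (rule openin_open_Int)
  moreover have "A0 \<in> ?S \<inter> (T \<inter> a -` P)" using A0S T P by simp
  moreover note V
  moreover have "\<exists>s. col_scale (exp_torus s) A \<in> U \<and>
        moment_map TYPE('k) (row_space (col_scale (exp_torus s) A)) = x"
    if A: "A \<in> ?S \<inter> (T \<inter> a -` P)" and x: "x \<in> V" "x \<in> rel_interior (polytope_of \<sigma>)" for A x
  proof -
    have "(a A, x) \<in> Y" using A x(1) PV by blast
    from Y(3)[OF this] obtain s where s: "norm s < e"
        "moment_map TYPE('k) (row_space (col_scale (exp_torus s) A)) = x"
      using moment_map_solution[OF \<sigma> _ x(2) e(1), of A] A unfolding a by blast
    have "(s, A) \<in> g -` O'" using s(1) e(2) A BT by (auto simp: subset_iff)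
    moreover have "col_scale (exp_torus s) A \<in> ?S"
      using A by (intro col_scale_in_stratum_frames exp_torus_in_algebraic_torus) simp
    ultimately have "col_scale (exp_torus s) A \<in> U" by (simp add: O'(2) g_def)
    with s(2) show ?thesis by blast
  qed
  ultimately show ?thesis by (rule that)
qed

lemma torus_polar_decomposition:
  assumes "t \<in> algebraic_torus"
  obtains u s where "u \<in> compact_torus" "t = (\<chi> i. exp_torus s $ i * u $ i)"
proof (rule that)
  have t: "t $ i \<noteq> 0" for i using assms by (simp add: algebraic_torus_def)
  show "(\<chi> i. sgn (t $ i)) \<in> compact_torus"
    using t by (simp add: compact_torus_def norm_sgn)
  show "t = (\<chi> i. exp_torus (\<chi> i. 2 * ln (cmod (t $ i))) $ i * (\<chi> i. sgn (t $ i)) $ i)"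
    using t by (simp add: vec_eq_iff exp_torus_def sgn_eq)
qed

theorem proposition3p7:
  fixes \<sigma> :: "'n::{finite,linorder} set set"
  assumes "1 \<le> CARD('k::{finite,linorder})" and "CARD('k) \<le> CARD('n) - 1"
    and "\<sigma> \<subseteq> k_subsets TYPE('k)"
    and "stratum TYPE('k) \<sigma> \<noteq> {}"
  shows "homeomorphic_map
           (orbit_space compact_torus (stratum_topology TYPE('k) \<sigma>))
           (prod_topology (top_of_set (rel_interior (polytope_of \<sigma>))) (F_space TYPE('k) \<sigma>))
           (h_map TYPE('k))"
proof -
  note \<sigma> = assms(3)
  let ?S = "stratum_frames \<sigma> :: (complex^'n::{finite,linorder}^'k::{finite,linorder}) set"
  let ?Q = "orbit_space compact_torus (stratum_topology TYPE('k) \<sigma>)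
    :: (complex^'n::{finite,linorder}) set set topology"
  let ?F = "F_space TYPE('k) \<sigma> :: (complex^'n::{finite,linorder}) set set topology"
  let ?R = "rel_interior (polytope_of \<sigma>)"
  let ?Y = "prod_topology (top_of_set ?R) ?F"
  let ?\<mu> = "\<lambda>A :: complex^'n::{finite,linorder}^'k::{finite,linorder}. moment_map TYPE('k) (row_space A)"
  define orb where "orb A = torus_orbit algebraic_torus (row_space A)"
    for A :: "complex^'n::{finite,linorder}^'k::{finite,linorder}"
  define \<pi> where "\<pi> A = torus_orbit compact_torus (row_space A)"
    for A :: "complex^'n::{finite,linorder}^'k::{finite,linorder}"
  have quotient_\<pi>: "quotient_map (top_of_set ?S) ?Q \<pi>"
    unfolding \<pi>_def by (rule quotient_map_orbit_space)
  have quotient_orb: "quotient_map (top_of_set ?S) ?F orb"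
    unfolding orb_def F_space_def by (rule quotient_map_orbit_space)
  have top_Q: "topspace ?Q = \<pi> ` ?S" and top_F: "topspace ?F = orb ` ?S"
    using quotient_\<pi> quotient_orb by (simp_all add: quotient_map_def)

  have orb_scale: "orb (col_scale t A) = orb A" if "t \<in> algebraic_torus" for t A
    using algebraic_torus_orbit_torus_act[OF that, of "row_space A"]
    by (simp add: orb_def torus_act_row_space)
  have \<pi>_scale: "\<pi> (col_scale t A) = \<pi> A" if "t \<in> compact_torus" for t A
    using compact_torus_orbit_torus_act[OF that, of "row_space A"]
    by (simp add: \<pi>_def torus_act_row_space)

  have h_\<pi>: "h_map TYPE('k) (\<pi> A) = (?\<mu> A, orb A)" if A: "A \<in> ?S" for A
  proof -
    have "(\<chi> i. 1) \<in> compact_torus" by (simp add: compact_torus_def)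
    \<comment> \<open>The orbit contains its representative, so the image defining an induced map is
      a singleton and not empty.\<close>
    then have mem: "row_space A \<in> \<pi> A"
      unfolding \<pi>_def torus_orbit_def by (intro image_eqI[where x = "\<chi> i. 1"]) (simp_all add: torus_act_one)
    have "mu_hat TYPE('k) (\<pi> A) = ?\<mu> A"
      unfolding mu_hat_def induced_map_def
      by (rule the_elem_image_constant[OF mem])
        (auto simp: \<pi>_def torus_orbit_def moment_map_compact_torus[OF \<sigma> A])
    moreover have "p_map (\<pi> A) = orb A"
      unfolding p_map_def induced_map_def
      by (rule the_elem_image_constant[OF mem])
        (use compact_torus_subset in \<open>auto simp: \<pi>_def orb_def torus_orbit_def[of compact_torus]
          intro!: algebraic_torus_orbit_torus_act\<close>)
    ultimately show ?thesis by (simp add: h_map_def)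
  qed

  have "continuous_map (top_of_set ?S) ?Y (\<lambda>A. (?\<mu> A, orb A))"
  proof (rule continuous_map_pairedI)
    show "continuous_map (top_of_set ?S) (top_of_set ?R) ?\<mu>"
      using continuous_on_moment_map[OF \<sigma>] moment_map_in_rel_interior[OF \<sigma>] by auto
    show "continuous_map (top_of_set ?S) ?F orb"
      by (rule quotient_imp_continuous_map[OF quotient_orb])
  qed
  \<comment> \<open>Continuity checked on frames descends along the quotient map
    \<open>\<pi>\<close>.\<close>
  then have "continuous_map (top_of_set ?S) ?Y (h_map TYPE('k) \<circ> \<pi>)"
    by (rule continuous_map_eq) (simp add: h_\<pi>)
  then have continuous: "continuous_map ?Q ?Y (h_map TYPE('k))"
    by (rule continuous_compose_quotient_map[OF quotient_\<pi>])

  have surj: "h_map TYPE('k) ` topspace ?Q = topspace ?Y"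
  proof
    show "h_map TYPE('k) ` topspace ?Q \<subseteq> topspace ?Y"
      by (rule continuous_map_image_subset_topspace[OF continuous])
    show "topspace ?Y \<subseteq> h_map TYPE('k) ` topspace ?Q"
    proof
      fix y assume "y \<in> topspace ?Y"
      then obtain x A where y: "y = (x, orb A)" and x: "x \<in> ?R" and A: "A \<in> ?S"
        by (auto simp: top_F)
      obtain s where s: "?\<mu> (col_scale (exp_torus s) A) = x"
        using moment_map_surjective_on_orbit[OF \<sigma> A x] by blast
      have B: "col_scale (exp_torus s) A \<in> ?S"
        by (rule col_scale_in_stratum_frames[OF A exp_torus_in_algebraic_torus])
      have "h_map TYPE('k) (\<pi> (col_scale (exp_torus s) A)) = y"
        by (simp add: h_\<pi>[OF B] s y orb_scale exp_torus_in_algebraic_torus)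
      then show "y \<in> h_map TYPE('k) ` topspace ?Q"
        unfolding top_Q using B by blast
    qed
  qed

  have inj: "inj_on (h_map TYPE('k)) (topspace ?Q)"
    unfolding top_Q
  proof (clarsimp simp: inj_on_def h_\<pi>)
    fix A B assume A: "A \<in> ?S" and \<mu>: "?\<mu> A = ?\<mu> B" and "orb A = orb B"
    then obtain t where t: "t \<in> algebraic_torus" "row_space B = row_space (col_scale t A)"
      unfolding orb_def by (auto simp: torus_act_row_space elim: algebraic_torus_orbit_eqD)
    \<comment> \<open>The compact factor \<open>u\<close> changes neither the moment nor the compact
      orbit, so it is absorbed into the frame; injectivity along the positive factor then identifies
      the row spaces.\<close>
    obtain u s where u: "u \<in> compact_torus" and tu: "t = (\<chi> i. exp_torus s $ i * u $ i)"
      using torus_polar_decomposition[OF t(1)] by blast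
    let ?C = "col_scale u A"
    have C: "?C \<in> ?S" using A u compact_torus_subset by (intro col_scale_in_stratum_frames) auto
    have BC: "row_space B = row_space (col_scale (exp_torus s) ?C)"
      by (simp add: t(2) tu col_scale_col_scale)
    have "?\<mu> ?C = ?\<mu> A"
      using moment_map_compact_torus[OF \<sigma> A u] by (simp add: torus_act_row_space)
    then have "row_space B = row_space ?C"
      unfolding BC using \<mu> BC by (intro moment_map_injective_on_orbit[OF \<sigma> C]) simp
    then have "\<pi> B = \<pi> ?C" by (simp add: \<pi>_def)
    then show "\<pi> A = \<pi> B" by (simp add: \<pi>_scale[OF u])
  qed

  have "open_map ?Q ?Y (h_map TYPE('k))"
    unfolding open_map_def
  proof (intro allI impI)
    fix G assume G: "openin ?Q G"
    \<comment> \<open>The preimage of \<open>G\<close> among the frames; as \<open>\<pi>\<close> is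
      onto, \<open>G\<close> is the image of \<open>U\<close>.\<close>
    define U where "U = {A \<in> ?S. \<pi> A \<in> G}"
    have U: "openin (top_of_set ?S) U"
      using openin_continuous_map_preimage[OF quotient_imp_continuous_map[OF quotient_\<pi>] G]
      by (simp add: U_def)
    have "G = \<pi> ` U" using openin_subset[OF G] by (auto simp: U_def top_Q)
    then have "h_map TYPE('k) ` G = (\<lambda>A. h_map TYPE('k) (\<pi> A)) ` U" by (simp add: image_image)
    also have "\<dots> = (\<lambda>A. (?\<mu> A, orb A)) ` U"
      by (rule image_cong) (simp_all add: U_def h_\<pi>)
    finally have hG: "h_map TYPE('k) ` G = (\<lambda>A. (?\<mu> A, orb A)) ` U" .
    show "openin ?Y (h_map TYPE('k) ` G)"
      unfolding hG
    proof (subst openin_subopen, intro ballI)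
      fix y assume "y \<in> (\<lambda>A. (?\<mu> A, orb A)) ` U"
      then obtain A0 where A0: "A0 \<in> U" and y: "y = (?\<mu> A0, orb A0)" by blast
      from moment_map_solution_nearby[OF \<sigma> A0 U]
      obtain N V where N: "openin (top_of_set ?S) N" "A0 \<in> N" and V: "open V" "?\<mu> A0 \<in> V"
        and solve: "\<And>A x. A \<in> N \<Longrightarrow> x \<in> V \<Longrightarrow> x \<in> ?R \<Longrightarrow>
          \<exists>s. col_scale (exp_torus s) A \<in> U \<and> ?\<mu> (col_scale (exp_torus s) A) = x"
        by blast
      have "openin (top_of_set ?R) (?R \<inter> V)" using V(1) by (rule openin_open_Int)
      moreover have "openin ?F (orb ` N)"
        using open_map_algebraic_torus_orbit N(1) unfolding open_map_def orb_def by blast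
      ultimately have "openin ?Y ((?R \<inter> V) \<times> orb ` N)" by (simp add: openin_prod_Times_iff)
      moreover have "y \<in> (?R \<inter> V) \<times> orb ` N"
        using y A0 N(2) V(2) moment_map_in_rel_interior[OF \<sigma>] by (auto simp: U_def)
      \<comment> \<open>Rescaling \<open>A\<close> by a suitable \<open>exp_torus s\<close> produces
        the moment \<open>x\<close> within \<open>U\<close> and leaves the algebraic orbit
        unchanged, so both coordinates are attained at once.\<close>
      moreover have "(?R \<inter> V) \<times> orb ` N \<subseteq> (\<lambda>A. (?\<mu> A, orb A)) ` U"
      proof clarify
        fix x A assume "x \<in> ?R" "x \<in> V" "A \<in> N"
        then obtain s where "col_scale (exp_torus s) A \<in> U" "?\<mu> (col_scale (exp_torus s) A) = x"
          using solve by blast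
        then show "(x, orb A) \<in> (\<lambda>A. (?\<mu> A, orb A)) ` U"
          by (intro image_eqI[of _ _ "col_scale (exp_torus s) A"])
            (simp_all add: orb_scale exp_torus_in_algebraic_torus)
      qed
      ultimately show "\<exists>T. openin ?Y T \<and> y \<in> T \<and> T \<subseteq> (\<lambda>A. (?\<mu> A, orb A)) ` U" by blast
    qed
  qed
  then show ?thesis
    by (rule bijective_open_imp_homeomorphic_map[OF continuous _ surj inj])
qed

end
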